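(* Let $k$ be an algebraically closed field of characteristic $0$, and let $\mathcal L$ and $\mathcal L'$ be fgc centreless Lie tori over $k$ that satisfy Assumption (C). Then $\mathcal L$ is isomorphic to $\mathcal L'$ if and only if $\mathcal L$ is isotopic to $\mathcal L'$.
   Context: An irreducible finite root system is a finite subset $\Delta$ of a finite-dimensional vector space with $0\in\Delta$ and $\Delta^\times:=\Delta\setminus\{0\}$ an irreducible (possibly non-reduced) root system in the usual sense; $Q=\mathrm{span}_{\mathbb Z}\Delta$, $\alpha^\vee$ coroots, $\Delta^\times_{\mathrm{ind}}=\Delta^\times\setminus2\Delta^\times$. Let $\Lambda$ be a finitely generated free abelian group. A Lie torus of type $(\Delta,\Lambda)$ is a Lie algebra $\mathcal L$ over $k$ with a $Q\times\Lambda$-grading $\mathcal L=\bigoplus\mathcal L_\alpha^\lambda$ ($\mathcal L_\alpha:=\bigoplus_\lambda\mathcal L_\alpha^\lambda$, $\mathcal L^\lambda:=\bigoplus_\alpha\mathcal L_\alpha^\lambda$) such that: (LT1) $\{\alpha:\mathcal L_\alpha\neq0\}=\Delta$; (LT2)(i) $\mathcal L_\alpha^0\neq0$ for $\alpha\in\Delta^\times_{\mathrm{ind}}$; (ii) whenever $\alpha\in\Delta^\times$ and $\mathcal L_\alpha^\lambda\ne0$ there are $e\in\mathcal L_\alpha^\lambda$, $f\in\mathcal L_{-\alpha}^{-\lambda}$ with $\mathcal L_\alpha^\lambda=ke$, $\mathcal L_{-\alpha}^{-\lambda}=kf$, $[[e,f],x]=\langle\beta,\alpha^\vee\rangle x$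 for $x\in\mathcal L_\beta$, $\beta\in Q$; (LT3) $\mathcal L$ is generated by the $\mathcal L_\alpha$, $\alpha\in\Delta^\times$; (LT4) $\Lambda$ is generated by $\{\lambda:\mathcal L^\lambda\ne0\}$. Centroid $C=\{c\in\mathrm{End}_k\mathcal L:c[x,y]=[cx,y]=[x,cy]\}$; fgc = finitely generated over $C$; centreless = zero centre. An isotopy from $\mathcal L$ (type $(\Delta,\Lambda)$) onto $\mathcal L'$ (type $(\Delta',\Lambda')$) is an algebra isomorphism $\varphi$ with $\varphi(\mathcal L_\alpha^\lambda)=\mathcal L'^{\,\varphi_e(\lambda)+\varphi_s(\alpha)}_{\varphi_r(\alpha)}$ for all $\alpha,\lambda$, where $\varphi_r:Q\to Q'$, $\varphi_e:\Lambda\to\Lambda'$ are group isomorphisms and $\varphi_s:Q\to\Lambda'$ is a homomorphism. An fgc centreless Lie algebra $\mathcal L$ satisfies Assumption (C) if: whenever $\mathcal L$ carries a Lie torus structure of type $(\Delta,\Lambda)$ with $\mathfrak h=\mathcal L_0^0$ and (the same algebra) $\mathcal L$ carries a Lie torus structure of type $(\Delta',\Lambda')$ with degree-$(0,0)$ component $\mathfrak h'$, there exists an automorphism $\varphi$ of $\mathcal L$ with $\varphi(\mathfrak h)=\mathfrak h'$. *)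

theory Defs
  imports Main "HOL-Library.Function_Algebras" "HOL-Computational_Algebra.Polynomial"
begin

definition alg_closed :: "'k::field itself \<Rightarrow> bool" where
  "alg_closed _ \<longleftrightarrow> (\<forall>p :: 'k poly. degree p \<ge> 1 \<longrightarrow> (\<exists>x. poly p x = 0))"

definition lie_algebra :: "('k::field \<Rightarrow> 'a::ab_group_add \<Rightarrow> 'a) \<Rightarrow> ('a \<Rightarrow> 'a \<Rightarrow> 'a) \<Rightarrow> bool" where
  "lie_algebra sc br \<longleftrightarrow>
     vector_space sc \<and>
     (\<forall>y. Vector_Spaces.linear sc sc (\<lambda>x. br x y)) \<and>
     (\<forall>x. Vector_Spaces.linear sc sc (\<lambda>y. br x y)) \<and>
     (\<forall>x. br x x = 0) \<and>
     (\<forall>x y z. br x (br y z) + br y (br z x) + br z (br x y) = 0)"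

definition centreless :: "('a::zero \<Rightarrow> 'a \<Rightarrow> 'a) \<Rightarrow> bool" where
  "centreless br \<longleftrightarrow> (\<forall>z. (\<forall>x. br z x = 0) \<longrightarrow> z = 0)"

definition centroid :: "('k::field \<Rightarrow> 'a::ab_group_add \<Rightarrow> 'a) \<Rightarrow> ('a \<Rightarrow> 'a \<Rightarrow> 'a) \<Rightarrow> ('a \<Rightarrow> 'a) set" where
  "centroid sc br = {c. Vector_Spaces.linear sc sc c \<and>
      (\<forall>x y. c (br x y) = br (c x) y \<and> c (br x y) = br x (c y))}"

definition fgc :: "('k::field \<Rightarrow> 'a::ab_group_add \<Rightarrow> 'a) \<Rightarrow> ('a \<Rightarrow> 'a \<Rightarrow> 'a) \<Rightarrow> bool" where
  "fgc sc br \<longleftrightarrow> (\<exists>S. finite S \<and>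
      (\<forall>x. \<exists>c. (\<forall>s\<in>S. c s \<in> centroid sc br) \<and> x = (\<Sum>s\<in>S. c s s)))"

definition lie_hom :: "('k::field \<Rightarrow> 'a::ab_group_add \<Rightarrow> 'a) \<Rightarrow> ('a \<Rightarrow> 'a \<Rightarrow> 'a)
     \<Rightarrow> ('k \<Rightarrow> 'b::ab_group_add \<Rightarrow> 'b) \<Rightarrow> ('b \<Rightarrow> 'b \<Rightarrow> 'b) \<Rightarrow> ('a \<Rightarrow> 'b) \<Rightarrow> bool" where
  "lie_hom sc br sc' br' \<phi> \<longleftrightarrow>
     Vector_Spaces.linear sc sc' \<phi> \<and> (\<forall>x y. \<phi> (br x y) = br' (\<phi> x) (\<phi> y))"

definition lie_iso :: "('k::field \<Rightarrow> 'a::ab_group_add \<Rightarrow> 'a) \<Rightarrow> ('a \<Rightarrow> 'a \<Rightarrow> 'a)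
     \<Rightarrow> ('k \<Rightarrow> 'b::ab_group_add \<Rightarrow> 'b) \<Rightarrow> ('b \<Rightarrow> 'b \<Rightarrow> 'b) \<Rightarrow> ('a \<Rightarrow> 'b) \<Rightarrow> bool" where
  "lie_iso sc br sc' br' \<phi> \<longleftrightarrow> lie_hom sc br sc' br' \<phi> \<and> bij \<phi>"

definition lie_isomorphic :: "('k::field \<Rightarrow> 'a::ab_group_add \<Rightarrow> 'a) \<Rightarrow> ('a \<Rightarrow> 'a \<Rightarrow> 'a)
     \<Rightarrow> ('k \<Rightarrow> 'b::ab_group_add \<Rightarrow> 'b) \<Rightarrow> ('b \<Rightarrow> 'b \<Rightarrow> 'b) \<Rightarrow> bool" where
  "lie_isomorphic sc br sc' br' \<longleftrightarrow> (\<exists>\<phi>. lie_iso sc br sc' br' \<phi>)"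

definition lie_gen :: "('k::field \<Rightarrow> 'a::ab_group_add \<Rightarrow> 'a) \<Rightarrow> ('a \<Rightarrow> 'a \<Rightarrow> 'a) \<Rightarrow> 'a set \<Rightarrow> 'a set" where
  "lie_gen sc br S = \<Inter>{T. module.subspace sc T \<and> (\<forall>x\<in>T. \<forall>y\<in>T. br x y \<in> T) \<and> S \<subseteq> T}"

definition subgroup_gen :: "'g::ab_group_add set \<Rightarrow> 'g set" where
  "subgroup_gen S = \<Inter>{H. 0 \<in> H \<and> (\<forall>x\<in>H. \<forall>y\<in>H. x + y \<in> H) \<and> (\<forall>x\<in>H. - x \<in> H) \<and> S \<subseteq> H}"

definition is_group_hom :: "'g::ab_group_add set \<Rightarrow> 'h::ab_group_add set \<Rightarrow> ('g \<Rightarrow> 'h) \<Rightarrow> bool" where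
  "is_group_hom A B f \<longleftrightarrow> f ` A \<subseteq> B \<and> (\<forall>x\<in>A. \<forall>y\<in>A. f (x + y) = f x + f y)"

definition is_group_iso :: "'g::ab_group_add set \<Rightarrow> 'h::ab_group_add set \<Rightarrow> ('g \<Rightarrow> 'h) \<Rightarrow> bool" where
  "is_group_iso A B f \<longleftrightarrow> is_group_hom A B f \<and> bij_betw f A B"

text \<open>The free abelian group of rank n, realised as \<int>^n inside nat => int.
  Every finitely generated free abelian group is isomorphic to one of these.\<close>
definition Zn :: "nat \<Rightarrow> (nat \<Rightarrow> int) set" where
  "Zn n = {l. \<forall>i\<ge>n. l i = 0}"

type_synonym rvec = "nat \<Rightarrow> real"

definition fsupp :: "rvec \<Rightarrow> bool" where
  "fsupp v \<longleftrightarrow> finite {i. v i \<noteq> 0}"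

definition rdot :: "rvec \<Rightarrow> rvec \<Rightarrow> real" where
  "rdot v w = (\<Sum>i\<in>{i. v i \<noteq> 0}. v i * w i)"

definition rscale :: "real \<Rightarrow> rvec \<Rightarrow> rvec" where
  "rscale c v = (\<lambda>i. c * v i)"

definition cartan :: "rvec \<Rightarrow> rvec \<Rightarrow> real" where
  "cartan \<beta> \<alpha> = 2 * rdot \<beta> \<alpha> / rdot \<alpha> \<alpha>"

text \<open>Root system in the usual (Humphreys) sense, possibly non-reduced, in the
  Euclidean space spanned by R (standard inner product).\<close>
definition root_system :: "rvec set \<Rightarrow> bool" where
  "root_system R \<longleftrightarrow> finite R \<and> 0 \<notin> R \<and> (\<forall>\<alpha>\<in>R. fsupp \<alpha>) \<and>
     (\<forall>\<alpha>\<in>R. \<forall>\<beta>\<in>R. \<beta> - rscale (cartan \<beta> \<alpha>) \<alpha> \<in> R) \<and>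
     (\<forall>\<alpha>\<in>R. \<forall>\<beta>\<in>R. cartan \<beta> \<alpha> \<in> \<int>)"

definition irreducible_root_system :: "rvec set \<Rightarrow> bool" where
  "irreducible_root_system R \<longleftrightarrow> root_system R \<and> R \<noteq> {} \<and>
     \<not> (\<exists>A B. A \<union> B = R \<and> A \<inter> B = {} \<and> A \<noteq> {} \<and> B \<noteq> {} \<and>
           (\<forall>a\<in>A. \<forall>b\<in>B. rdot a b = 0))"

definition irred_finite_root_system :: "rvec set \<Rightarrow> bool" where
  "irred_finite_root_system D \<longleftrightarrow> 0 \<in> D \<and> irreducible_root_system (D - {0})"

definition indivisible_roots :: "rvec set \<Rightarrow> rvec set" where
  "indivisible_roots D = (D - {0}) - rscale 2 ` (D - {0})"

text \<open>A Q x Lambda grading is given by G alpha lambda, the homogeneous subspace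
  L_alpha^lambda, indexed by rvec x (nat => int) and required to vanish outside Q x Lambda.\<close>

definition gcomp_root :: "('k::field \<Rightarrow> 'a::ab_group_add \<Rightarrow> 'a) \<Rightarrow> (rvec \<Rightarrow> (nat \<Rightarrow> int) \<Rightarrow> 'a set) \<Rightarrow> rvec \<Rightarrow> 'a set" where
  "gcomp_root sc G \<alpha> = module.span sc (\<Union>la. G \<alpha> la)"

definition is_grading :: "('k::field \<Rightarrow> 'a::ab_group_add \<Rightarrow> 'a) \<Rightarrow> ('a \<Rightarrow> 'a \<Rightarrow> 'a)
     \<Rightarrow> rvec set \<Rightarrow> (nat \<Rightarrow> int) set \<Rightarrow> (rvec \<Rightarrow> (nat \<Rightarrow> int) \<Rightarrow> 'a set) \<Rightarrow> bool" where
  "is_grading sc br Q Lam G \<longleftrightarrow>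
     (\<forall>\<alpha> la. module.subspace sc (G \<alpha> la)) \<and>
     (\<forall>\<alpha> la. (\<alpha> \<notin> Q \<or> la \<notin> Lam) \<longrightarrow> G \<alpha> la = {0}) \<and>
     (\<forall>x. \<exists>!f. finite {p. f (fst p) (snd p) \<noteq> 0} \<and> (\<forall>\<alpha> la. f \<alpha> la \<in> G \<alpha> la) \<and>
              x = (\<Sum>p\<in>{p. f (fst p) (snd p) \<noteq> 0}. f (fst p) (snd p))) \<and>
     (\<forall>\<alpha> \<beta> la mu. \<forall>x\<in>G \<alpha> la. \<forall>y\<in>G \<beta> mu. br x y \<in> G (\<alpha> + \<beta>) (la + mu))"

definition lie_torus :: "('k::field \<Rightarrow> 'a::ab_group_add \<Rightarrow> 'a) \<Rightarrow> ('a \<Rightarrow> 'a \<Rightarrow> 'a)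
     \<Rightarrow> rvec set \<Rightarrow> nat \<Rightarrow> (rvec \<Rightarrow> (nat \<Rightarrow> int) \<Rightarrow> 'a set) \<Rightarrow> bool" where
  "lie_torus sc br D n G \<longleftrightarrow>
     lie_algebra sc br \<and> irred_finite_root_system D \<and>
     is_grading sc br (subgroup_gen D) (Zn n) G \<and>
     \<comment> \<open>LT1\<close>
     {\<alpha>. \<exists>la. G \<alpha> la \<noteq> {0}} = D \<and>
     \<comment> \<open>LT2 (i)\<close>
     (\<forall>\<alpha>\<in>indivisible_roots D. G \<alpha> 0 \<noteq> {0}) \<and>
     \<comment> \<open>LT2 (ii)\<close>
     (\<forall>\<alpha>\<in>D - {0}. \<forall>la. G \<alpha> la \<noteq> {0} \<longrightarrow>
        (\<exists>e f. e \<in> G \<alpha> la \<and> f \<in> G (- \<alpha>) (- la) \<and>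
           G \<alpha> la = {sc c e | c. True} \<and> G (- \<alpha>) (- la) = {sc c f | c. True} \<and>
           (\<forall>\<beta>\<in>subgroup_gen D. \<forall>m::int. real_of_int m = cartan \<beta> \<alpha> \<longrightarrow>
              (\<forall>x\<in>gcomp_root sc G \<beta>. br (br e f) x = sc (of_int m) x)))) \<and>
     \<comment> \<open>LT3\<close>
     lie_gen sc br (\<Union>\<alpha>\<in>D - {0}. gcomp_root sc G \<alpha>) = UNIV \<and>
     \<comment> \<open>LT4\<close>
     subgroup_gen {la. \<exists>\<alpha>. G \<alpha> la \<noteq> {0}} = Zn n"

definition isotopy :: "('k::field \<Rightarrow> 'a::ab_group_add \<Rightarrow> 'a) \<Rightarrow> ('a \<Rightarrow> 'a \<Rightarrow> 'a)
     \<Rightarrow> rvec set \<Rightarrow> nat \<Rightarrow> (rvec \<Rightarrow> (nat \<Rightarrow> int) \<Rightarrow> 'a set)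
     \<Rightarrow> ('k \<Rightarrow> 'b::ab_group_add \<Rightarrow> 'b) \<Rightarrow> ('b \<Rightarrow> 'b \<Rightarrow> 'b)
     \<Rightarrow> rvec set \<Rightarrow> nat \<Rightarrow> (rvec \<Rightarrow> (nat \<Rightarrow> int) \<Rightarrow> 'b set) \<Rightarrow> ('a \<Rightarrow> 'b) \<Rightarrow> bool" where
  "isotopy sc br D n G sc' br' D' n' G' \<phi> \<longleftrightarrow>
     lie_iso sc br sc' br' \<phi> \<and>
     (\<exists>\<phi>r \<phi>e \<phi>s.
        is_group_iso (subgroup_gen D) (subgroup_gen D') \<phi>r \<and>
        is_group_iso (Zn n) (Zn n') \<phi>e \<and>
        is_group_hom (subgroup_gen D) (Zn n') \<phi>s \<and>
        (\<forall>\<alpha>\<in>subgroup_gen D. \<forall>la\<in>Zn n.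
           \<phi> ` G \<alpha> la = G' (\<phi>r \<alpha>) (\<phi>e la + \<phi>s \<alpha>)))"

definition isotopic :: "('k::field \<Rightarrow> 'a::ab_group_add \<Rightarrow> 'a) \<Rightarrow> ('a \<Rightarrow> 'a \<Rightarrow> 'a)
     \<Rightarrow> rvec set \<Rightarrow> nat \<Rightarrow> (rvec \<Rightarrow> (nat \<Rightarrow> int) \<Rightarrow> 'a set)
     \<Rightarrow> ('k \<Rightarrow> 'b::ab_group_add \<Rightarrow> 'b) \<Rightarrow> ('b \<Rightarrow> 'b \<Rightarrow> 'b)
     \<Rightarrow> rvec set \<Rightarrow> nat \<Rightarrow> (rvec \<Rightarrow> (nat \<Rightarrow> int) \<Rightarrow> 'b set) \<Rightarrow> bool" where
  "isotopic sc br D n G sc' br' D' n' G' \<longleftrightarrow> (\<exists>\<phi>. isotopy sc br D n G sc' br' D' n' G' \<phi>)"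

definition assumption_C :: "('k::field \<Rightarrow> 'a::ab_group_add \<Rightarrow> 'a) \<Rightarrow> ('a \<Rightarrow> 'a \<Rightarrow> 'a) \<Rightarrow> bool" where
  "assumption_C sc br \<longleftrightarrow>
     (\<forall>D n G D' n' G'. lie_torus sc br D n G \<longrightarrow> lie_torus sc br D' n' G' \<longrightarrow>
        (\<exists>\<phi>. lie_iso sc br sc br \<phi> \<and> \<phi> ` G 0 0 = G' 0 0))"

end

theory Submission
  imports Defs "HOL-Library.Product_Plus"
begin

text \<open>
  Transporting the grading of the first torus along an isomorphism and applying Assumption (C), we
  may assume that one algebra carries two Lie torus gradings with the same degree \<open>(0,0)\<close> component
  \<open>h\<close>; then the identity is an isotopy. The root spaces are the joint eigenspaces of \<open>h\<close>, which
  gives the isomorphism of root lattices. For a root \<open>\<alpha>\<close>, a nonzero \<open>x\<close> in \<open>L\<^sub>\<alpha>\<close> is homogeneous if and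
  only if \<open>[x, y]\<close> is a nonzero element of \<open>h\<close> for some \<open>y\<close> in \<open>L\<close> of root \<open>-\<alpha>\<close> (compare leading and
  lowest terms in a translation-invariant total order), so both gradings have the same homogeneous
  elements in root spaces. Let \<open>\<tau> \<alpha> l\<close> be the new degree of the component of degree \<open>(\<alpha>, l)\<close>.
  Representation theory of \<open>sl\<^sub>2\<close> shows that \<open>\<tau>\<close> is compatible with reflections:
  \<open>\<tau> (s\<^sub>\<alpha> \<beta>) (\<mu> - m l) = \<tau> \<beta> \<mu> - m \<tau> \<alpha> l\<close> with \<open>m\<close> the Cartan integer of \<open>\<beta>\<close> and \<open>\<alpha>\<close>. This forces \<open>\<tau>\<close> to be affine:
  \<open>\<alpha> \<mapsto> \<tau> \<alpha> 0\<close> extends additively to the root lattice by averaging over the roots,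
  and after subtracting it \<open>\<tau>\<close> is given by translations which determine a homomorphism of the
  torsion-free grading groups.
\<close>

section \<open>Generated subgroups and homomorphisms given by their graphs\<close>

text \<open>Degree 0 is guaranteed only for indivisible roots, and this shapes the second half. The
  values \<open>\<tau> \<alpha> 0\<close> are available on \<open>J\<close> alone, so both the
  averaging and the normalisation take place there. A divisible root \<open>2 \<delta>\<close> is
  reached because it defines the same reflection as \<delta>. Averaging over all of \<open>J\<close>
  avoids choosing a base of simple roots: the sum is symmetric under every reflection, and it
  returns \<open>\<tau> \<alpha> 0\<close> up to one positive constant.

  Translations arise as in an affine Weyl group: reflecting in \<alpha> at degree l and then in the
  same hyperplane at degree 0 moves the degrees of \<beta> by a Cartan multiple of l. Only multiples
  of l are obtained in this way, so translations are compared up to a nonzero integer factor, which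
  torsion-freeness removes again.

  The spaces of root 0 need not be lines, and \<tau> says nothing about them. They are spanned by
  brackets of opposite root vectors, which gives one inclusion between the two gradings; the other
  follows from uniqueness of homogeneous decompositions.

  All homomorphisms are built from the subgroup generated by the graph of a map on generators, since
  neither lattice comes with a basis adapted to the degrees.\<close>

lemma subgroup_gen_base: "x \<in> S \<Longrightarrow> x \<in> subgroup_gen S"
  and subgroup_gen_zero: "0 \<in> subgroup_gen S"
  and subgroup_gen_add: "x \<in> subgroup_gen S \<Longrightarrow> y \<in> subgroup_gen S \<Longrightarrow> x + y \<in> subgroup_gen S"
  and subgroup_gen_minus: "x \<in> subgroup_gen S \<Longrightarrow> - x \<in> subgroup_gen S"
  by (auto simp: subgroup_gen_def)

lemma subgroup_gen_diff: "x \<in> subgroup_gen S \<Longrightarrow> y \<in> subgroup_gen S \<Longrightarrow> x - y \<in> subgroup_gen S"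
  using subgroup_gen_add[of x S "- y"] subgroup_gen_minus by auto

lemma subgroup_gen_induct [consumes 1, case_names base zero add minus]:
  assumes "x \<in> subgroup_gen S"
    and "\<And>x. x \<in> S \<Longrightarrow> P x" and "P 0"
    and "\<And>x y. P x \<Longrightarrow> P y \<Longrightarrow> P (x + y)" and "\<And>x. P x \<Longrightarrow> P (- x)"
  shows "P x"
  using assms unfolding subgroup_gen_def by (auto dest!: spec[where x = "Collect P"])

lemma subgroup_gen_least:
  assumes "S \<subseteq> H" "0 \<in> H" "\<And>x y. x \<in> H \<Longrightarrow> y \<in> H \<Longrightarrow> x + y \<in> H" "\<And>x. x \<in> H \<Longrightarrow> - x \<in> H"
  shows "subgroup_gen S \<subseteq> H"
  using assms by (auto simp: subgroup_gen_def)

lemma subgroup_gen_mono: "S \<subseteq> subgroup_gen T \<Longrightarrow> subgroup_gen S \<subseteq> subgroup_gen T"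
  by (rule subgroup_gen_least) (auto intro: subgroup_gen_zero subgroup_gen_add subgroup_gen_minus)

lemma fst_subgroup_gen: "fst ` subgroup_gen S = subgroup_gen (fst ` S)"
proof (intro equalityI subsetI)
  fix x assume "x \<in> fst ` subgroup_gen S"
  then obtain p where "p \<in> subgroup_gen S" "x = fst p" by auto
  then show "x \<in> subgroup_gen (fst ` S)"
    by (induction arbitrary: x rule: subgroup_gen_induct)
      (auto intro: subgroup_gen_base subgroup_gen_zero subgroup_gen_add subgroup_gen_minus)
next
  fix x assume "x \<in> subgroup_gen (fst ` S)"
  then show "x \<in> fst ` subgroup_gen S"
  proof (induction rule: subgroup_gen_induct)
    case (base x) then show ?case by (auto intro: subgroup_gen_base)
  next
    case zero show ?case using subgroup_gen_zero[of S] by force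
  next
    case (add x y) then show ?case using subgroup_gen_add[of _ S] by (auto simp: image_iff) (metis fst_add fst_conv)
  next
    case (minus x) then show ?case using subgroup_gen_minus[of _ S] by (auto simp: image_iff) (metis fst_uminus fst_conv)
  qed
qed

lemma snd_subgroup_gen: "snd ` subgroup_gen S = subgroup_gen (snd ` S)"
proof (intro equalityI subsetI)
  fix x assume "x \<in> snd ` subgroup_gen S"
  then obtain p where "p \<in> subgroup_gen S" "x = snd p" by auto
  then show "x \<in> subgroup_gen (snd ` S)"
    by (induction arbitrary: x rule: subgroup_gen_induct)
      (auto intro: subgroup_gen_base subgroup_gen_zero subgroup_gen_add subgroup_gen_minus)
next
  fix x assume "x \<in> subgroup_gen (snd ` S)"
  then show "x \<in> snd ` subgroup_gen S"
  proof (induction rule: subgroup_gen_induct)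
    case (base x) then show ?case by (auto intro: subgroup_gen_base)
  next
    case zero show ?case using subgroup_gen_zero[of S] by force
  next
    case (add x y) then show ?case using subgroup_gen_add[of _ S] by (auto simp: image_iff) (metis snd_add snd_conv)
  next
    case (minus x) then show ?case using subgroup_gen_minus[of _ S] by (auto simp: image_iff) (metis snd_uminus snd_conv)
  qed
qed

text \<open>A subgroup of a product is the graph of a function as soon as its fibre over 0 is
  trivial, because two values over the same point differ by an element of that fibre. This replaces
  any check of relations among the generators.\<close>

lemma graph_hom:
  fixes S :: "('g::ab_group_add \<times> 'h::ab_group_add) set"
  assumes "\<And>y. (0, y) \<in> subgroup_gen S \<Longrightarrow> y = 0"
  obtains f where "\<And>x y. (x, y) \<in> subgroup_gen S \<Longrightarrow> f x = y"
    and "is_group_hom (subgroup_gen (fst ` S)) (subgroup_gen (snd ` S)) f"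
proof -
  have uniq: "y = y'" if "(x, y) \<in> subgroup_gen S" "(x, y') \<in> subgroup_gen S" for x y y'
    using subgroup_gen_diff[OF that] assms[of "y - y'"] by simp
  define f where "f x = (THE y. (x, y) \<in> subgroup_gen S)" for x
  have f: "f x = y" if "(x, y) \<in> subgroup_gen S" for x y
    unfolding f_def using that uniq by blast
  show thesis
  proof (rule that[of f])
    show "is_group_hom (subgroup_gen (fst ` S)) (subgroup_gen (snd ` S)) f"
      unfolding is_group_hom_def fst_subgroup_gen[symmetric] snd_subgroup_gen[symmetric]
    proof (intro conjI ballI subsetI)
      fix x assume "x \<in> f ` fst ` subgroup_gen S"
      then show "x \<in> snd ` subgroup_gen S" using f by force
    next
      fix x y assume "x \<in> fst ` subgroup_gen S" "y \<in> fst ` subgroup_gen S"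
      then obtain a b where "(x, a) \<in> subgroup_gen S" "(y, b) \<in> subgroup_gen S" by auto
      then show "f (x + y) = f x + f y"
        using subgroup_gen_add[of "(x,a)" S "(y,b)"] f by auto
    qed
  qed (use f in auto)
qed

lemma graph_iso:
  fixes S :: "('g::ab_group_add \<times> 'h::ab_group_add) set"
  assumes "\<And>y. (0, y) \<in> subgroup_gen S \<Longrightarrow> y = 0" and "\<And>x. (x, 0) \<in> subgroup_gen S \<Longrightarrow> x = 0"
  obtains f where "\<And>x y. (x, y) \<in> subgroup_gen S \<Longrightarrow> f x = y"
    and "is_group_iso (subgroup_gen (fst ` S)) (subgroup_gen (snd ` S)) f"
proof -
  obtain f where f: "\<And>x y. (x, y) \<in> subgroup_gen S \<Longrightarrow> f x = y"
    and h: "is_group_hom (subgroup_gen (fst ` S)) (subgroup_gen (snd ` S)) f"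
    using graph_hom[OF assms(1)] by blast
  have "bij_betw f (fst ` subgroup_gen S) (snd ` subgroup_gen S)"
    unfolding bij_betw_def
  proof
    show "inj_on f (fst ` subgroup_gen S)"
    proof (rule inj_onI)
      fix x y assume "x \<in> fst ` subgroup_gen S" "y \<in> fst ` subgroup_gen S" and e: "f x = f y"
      then obtain a b where "(x, a) \<in> subgroup_gen S" "(y, b) \<in> subgroup_gen S" by auto
      then show "x = y"
        using subgroup_gen_diff[of "(x,a)" S "(y,b)"] f assms(2)[of "x - y"] e by auto
    qed
    show "f ` fst ` subgroup_gen S = snd ` subgroup_gen S" using f by force
  qed
  then show thesis using f h that by (auto simp: is_group_iso_def fst_subgroup_gen snd_subgroup_gen)
qed

lemma group_hom_zero: "is_group_hom A B f \<Longrightarrow> 0 \<in> A \<Longrightarrow> f 0 = 0"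
  unfolding is_group_hom_def by (metis add_cancel_right_left)

lemma group_hom_minus: "is_group_hom (subgroup_gen S) B f \<Longrightarrow> x \<in> subgroup_gen S \<Longrightarrow> f (- x) = - f x"
  using group_hom_zero[of "subgroup_gen S" B f] subgroup_gen_minus[of x S] subgroup_gen_zero[of S]
  unfolding is_group_hom_def by (metis add.right_inverse add_eq_0_iff)

text \<open>In the ring of functions \<open>of_int m\<close> is the constant function m, so this
  product is the m-fold multiple of x. Integer multiples of roots and of degrees are written in this
  way throughout.\<close>

lemma of_int_times_in_subgroup_gen:
  fixes x :: "'a::type \<Rightarrow> 'b::comm_ring_1"
  assumes "x \<in> subgroup_gen S" shows "of_int m * x \<in> subgroup_gen S"
proof (induction m rule: int_induct[of _ 0])
  case base show ?case by (simp only: of_int_0 mult_zero_left subgroup_gen_zero)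
next
  case (step1 i) then show ?case using subgroup_gen_add[OF step1(2) assms] by (simp only: distrib_right of_int_add of_int_1 mult_1_left)
next
  case (step2 i) then show ?case using subgroup_gen_diff[OF step2(2) assms] by (simp only: left_diff_distrib of_int_diff of_int_1 mult_1_left)
qed

lemma group_hom_of_int_times:
  fixes f :: "('a::type \<Rightarrow> 'b::comm_ring_1) \<Rightarrow> ('c::type \<Rightarrow> 'd::comm_ring_1)"
  assumes f: "is_group_hom (subgroup_gen S) B f" and x: "x \<in> subgroup_gen S"
  shows "f (of_int m * x) = of_int m * f x"
proof -
  have *: "f (of_int i * x + x) = f (of_int i * x) + f x" 
     "f (of_int i * x + - x) = f (of_int i * x) + f (- x)" for i
    using f x of_int_times_in_subgroup_gen[OF x] subgroup_gen_minus[OF x] by (auto simp: is_group_hom_def)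
  show ?thesis
  proof (induction m rule: int_induct[of _ 0])
    case base show ?case by (simp only: of_int_0 mult_zero_left group_hom_zero[OF f subgroup_gen_zero])
  next
    case (step1 i) then show ?case using *[of i] by (simp only: distrib_right of_int_add of_int_1 mult_1_left)
  next
    case (step2 i) then show ?case using *[of i] group_hom_minus[OF f x]
      by (simp only: left_diff_distrib of_int_diff of_int_1 mult_1_left add_uminus_conv_diff)
  qed
qed

section \<open>Strings for an action of the Lie algebra sl(2)\<close>

text \<open>\<open>V i\<close> plays the part of the weight space of weight
  \<open>m + 2 * i\<close>, on which the commutator of E and F acts by that weight. For a vector
  annihilated by E this is the classical highest weight computation; a general v is reduced to that
  case by climbing the string, which ends at B.\<close>

lemma sl2_string_nonzero:
  fixes sc :: "'k::field_char_0 \<Rightarrow> 'a::ab_group_add \<Rightarrow> 'a"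
  assumes vs: "vector_space sc" and linE: "Vector_Spaces.linear sc sc E" and linF: "Vector_Spaces.linear sc sc F"
    and E: "\<And>i x. x \<in> V i \<Longrightarrow> E x \<in> V (i + 1)" and F: "\<And>i x. x \<in> V i \<Longrightarrow> F x \<in> V (i - 1)"
    and EF: "\<And>i x. x \<in> V i \<Longrightarrow> E (F x) = F (E x) + sc (of_int (m + 2 * i)) x"
    and V: "\<And>i x. i \<ge> B \<Longrightarrow> x \<in> V i \<Longrightarrow> x = 0"
    and "v \<in> V i" "v \<noteq> 0" "m + 2 * i = int k"
  shows "(F ^^ k) v \<noteq> 0"
proof -
  interpret E: Vector_Spaces.linear sc sc E by (rule linE)
  interpret F: Vector_Spaces.linear sc sc F by (rule linF)
  have Fn: "(F ^^ j) x \<in> V (i - int j)" if "x \<in> V i" for i j x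
    using that F[of _ "i - int _"] by (induction j) (auto simp: algebra_simps)
  have F0: "(F ^^ j) 0 = 0" for j by (induction j) (auto simp: F.zero)
  \<comment> \<open>The usual commutation formula. At \<open>j = 0\<close> the term
    \<open>j - 1\<close> is truncated, but its coefficient vanishes.\<close>
  have comm: "E ((F ^^ j) x) = (F ^^ j) (E x) + sc (of_int (int j * (m + 2 * i - int j + 1))) ((F ^^ (j - 1)) x)"
    if "x \<in> V i" for i j x
  proof (induction j)
    case 0 then show ?case by simp
  next
    case (Suc j)
    have "E ((F ^^ Suc j) x) = F (E ((F ^^ j) x)) + sc (of_int (m + 2 * (i - int j))) ((F ^^ j) x)"
      using EF[OF Fn[OF that]] by simp
    also have "\<dots> = (F ^^ Suc j) (E x) + (sc (of_int (int j * (m + 2 * i - int j + 1))) (F ((F ^^ (j - 1)) x))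
        + sc (of_int (m + 2 * (i - int j))) ((F ^^ j) x))"
      by (simp add: Suc.IH F.add F.scale add.assoc)
    also have "sc (of_int (int j * (m + 2 * i - int j + 1))) (F ((F ^^ (j - 1)) x))
        = sc (of_int (int j * (m + 2 * i - int j + 1))) ((F ^^ j) x)"
      by (cases j) (auto simp: E.vs1.scale_zero_left)
    finally show ?case
      by (simp add: E.vs1.scale_left_distrib[symmetric] algebra_simps flip: of_int_add of_int_mult of_int_diff)
  qed
  \<comment> \<open>Induction on the distance to the top of the string: applying E raises i by one
    and the weight k by two.\<close>
  show ?thesis using assms(8-)
  proof (induction "nat (B - i)" arbitrary: i v k)
    case 0 then show ?case using V[of i v] by auto
  next
    case (Suc N)
    show ?case
    proof
      assume Fk: "(F ^^ k) v = 0"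
      show False
      proof (cases "E v = 0")
        case True
        \<comment> \<open>With \<open>E v = 0\<close> the coefficients j (k - j + 1) are nonzero for
          j from 1 to k, so the vanishing of the k-th power descends one power at a time to v
          itself.\<close>
        have "(F ^^ (k - j)) v = 0" if "j \<le> k" for j using that
        proof (induction j)
          case 0 then show ?case using Fk by simp
        next
          case (Suc j)
          have "(F ^^ (k - j)) v = 0" using Suc by simp
          moreover have "int (k - j) * (int k - int (k - j) + 1) \<noteq> 0" "k - Suc j = k - j - 1" using Suc.prems by auto
          moreover have "sc (of_int (int (k - j) * (int k - int (k - j) + 1))) ((F ^^ (k - j - 1)) v) = 0"
            using comm[OF \<open>v \<in> V i\<close>, of "k - j"] True \<open>m + 2 * i = int k\<close> calculation(1)
            by (simp only: E.zero F0 add_0_left)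
          ultimately show ?case
            by (simp only: E.vs1.scale_eq_0_iff of_int_eq_0_iff simp_thms)
        qed
        from this[of k] show False using Suc.prems by simp
      next
        case False
        \<comment> \<open>\<open>E v\<close> has weight \<open>k + 2\<close>, so the induction
          hypothesis forbids what \<open>comm\<close> forces: if the k-th power of F kills v, so do
          the next two powers, and both other terms of the formula vanish.\<close>
        have "(F ^^ (k + 2)) (E v) \<noteq> 0"
          by (rule Suc.hyps(1)[of "i+1"]) (use Suc E False in auto)
        moreover have "(F ^^ (k + j)) v = 0" for j
          using Fk by (induction j) (auto simp: F.zero)
        from this[of 1] this[of 2] have "(F ^^ (k + 2)) (E v) = 0"
          using comm[OF Suc.prems(1), of "k + 2"] by (simp add: E.zero)
        ultimately show False by simp
      qed
    qed
  qed
qed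

section \<open>Irreducible root systems\<close>

lemma of_int_fun_apply [simp]: "(of_int m :: 'a \<Rightarrow> 'b::ring_1) x = of_int m"
  by (induction m rule: int_induct[of _ 0]) auto

lemma rscale_of_int: "rscale (of_int m) v = of_int m * v"
  by (auto simp: rscale_def fun_eq_iff)

lemma rscale_simps [simp]: "rscale 1 v = v" "rscale c v i = c * v i" "rscale (-1) v = - v" "rscale 0 v = 0"
  by (auto simp: rscale_def fun_eq_iff)

lemma rdot_right: "rdot v (w + w') = rdot v w + rdot v w'" "rdot v (w - w') = rdot v w - rdot v w'"
  "rdot v (rscale c w) = c * rdot v w" "rdot v (- w) = - rdot v w" "rdot v 0 = 0"
  by (auto simp: rdot_def sum.distrib sum_subtractf sum_distrib_left algebra_simps sum_negf)

definition reflect :: "rvec \<Rightarrow> rvec \<Rightarrow> rvec" where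
  "reflect \<alpha> \<beta> = \<beta> - rscale (cartan \<beta> \<alpha>) \<alpha>"

locale irred_roots =
  fixes D :: "rvec set"
  assumes irr: "irred_finite_root_system D"
begin

abbreviation "R \<equiv> D - {0}"
abbreviation "J \<equiv> indivisible_roots D"
abbreviation "Q \<equiv> subgroup_gen D"

text \<open>\<open>rdot\<close> sums over the support of its first argument, so symmetry and
  additivity on the left need a common finite index set. \<open>coords\<close> supplies one for all
  roots, and \<open>V\<close> is the Euclidean space on these coordinates; it contains the root
  lattice.\<close>

definition "coords = (\<Union>\<alpha>\<in>R. {i. \<alpha> i \<noteq> 0})"
definition "V = {v::rvec. \<forall>i. i \<notin> coords \<longrightarrow> v i = 0}"

lemma finite_R: "finite R" and finite_D: "finite D" and zero_in_D: "0 \<in> D" and R_nonempty: "R \<noteq> {}"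
  and cartan_int: "\<alpha> \<in> R \<Longrightarrow> \<beta> \<in> R \<Longrightarrow> cartan \<beta> \<alpha> \<in> \<int>"
  and reflect_in: "\<alpha> \<in> R \<Longrightarrow> \<beta> \<in> R \<Longrightarrow> reflect \<alpha> \<beta> \<in> R"
  using irr unfolding irred_finite_root_system_def irreducible_root_system_def root_system_def reflect_def
  by auto

lemma finite_coords: "finite coords"
  using irr finite_R unfolding irred_finite_root_system_def irreducible_root_system_def root_system_def coords_def
  by (auto simp: fsupp_def)

lemma V_intros [intro, simp]:
  "\<alpha> \<in> D \<Longrightarrow> \<alpha> \<in> V" "0 \<in> V" "x \<in> V \<Longrightarrow> y \<in> V \<Longrightarrow> x + y \<in> V" "x \<in> V \<Longrightarrow> y \<in> V \<Longrightarrow> x - y \<in> V"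
  "x \<in> V \<Longrightarrow> - x \<in> V" "x \<in> V \<Longrightarrow> rscale c x \<in> V"
  by (auto simp: V_def coords_def)

lemma V_Q [intro, simp]: "x \<in> Q \<Longrightarrow> x \<in> V"
  using subgroup_gen_least[of D V] by auto

lemma rdot_eq: "x \<in> V \<Longrightarrow> rdot x y = (\<Sum>i\<in>coords. x i * y i)"
  unfolding rdot_def by (rule sum.mono_neutral_left) (auto simp: V_def finite_coords)

lemma rdot_commute: "x \<in> V \<Longrightarrow> y \<in> V \<Longrightarrow> rdot x y = rdot y x"
  by (simp add: rdot_eq mult.commute)

lemma rdot_left:
  assumes "x \<in> V" 
  shows "y \<in> V \<Longrightarrow> rdot (x + y) z = rdot x z + rdot y z" "y \<in> V \<Longrightarrow> rdot (x - y) z = rdot x z - rdot y z"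
   "rdot (rscale c x) z = c * rdot x z" "rdot (- x) z = - rdot x z" 
  using assms by (auto simp: rdot_eq sum.distrib sum_subtractf sum_distrib_left algebra_simps sum_negf)

lemma rdot_pos: "x \<in> V \<Longrightarrow> x \<noteq> 0 \<Longrightarrow> rdot x x > 0"
proof -
  assume x: "x \<in> V" "x \<noteq> 0"
  then obtain i where "x i \<noteq> 0" by (auto simp: fun_eq_iff)
  then show "rdot x x > 0"
    using x unfolding rdot_eq[OF x(1)]
    by (intro sum_pos2[of _ i]) (auto simp: finite_coords V_def zero_less_mult_iff)
qed

lemma cartan_left:
  assumes "x \<in> V" 
  shows "y \<in> V \<Longrightarrow> cartan (x + y) z = cartan x z + cartan y z" "y \<in> V \<Longrightarrow> cartan (x - y) z = cartan x z - cartan y z"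
   "cartan (rscale c x) z = c * cartan x z" "cartan (- x) z = - cartan x z" 
  using assms by (auto simp: cartan_def rdot_left add_divide_distrib diff_divide_distrib algebra_simps)

lemma cartan_self: "x \<in> R \<Longrightarrow> cartan x x = 2"
  using rdot_pos[of x] by (auto simp: cartan_def)

lemma cartan_minus: "x \<in> V \<Longrightarrow> cartan y (- x) = - cartan y x"
  by (auto simp: cartan_def rdot_right rdot_left)

lemma cartan_eq_0_iff: "x \<in> V \<Longrightarrow> y \<in> R \<Longrightarrow> cartan x y = 0 \<longleftrightarrow> rdot x y = 0"
  using rdot_pos[of y] by (auto simp: cartan_def)

lemma cartan_Q_int: assumes "\<beta> \<in> Q" "\<alpha> \<in> R" shows "cartan \<beta> \<alpha> \<in> \<int>"
proof -
  have "Q \<subseteq> {\<beta> \<in> V. cartan \<beta> \<alpha> \<in> \<int>}"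
  proof (rule subgroup_gen_least)
    show "D \<subseteq> {\<beta> \<in> V. cartan \<beta> \<alpha> \<in> \<int>}"
    proof
      fix x assume "x \<in> D"
      then show "x \<in> {\<beta> \<in> V. cartan \<beta> \<alpha> \<in> \<int>}" using cartan_int[of \<alpha> x] assms(2)
        by (cases "x = 0") (auto simp: cartan_def rdot_def)
    qed
    show "0 \<in> {\<beta> \<in> V. cartan \<beta> \<alpha> \<in> \<int>}" by (auto simp: cartan_def rdot_def)
  qed (auto simp: cartan_left)
  then show ?thesis using assms(1) by auto
qed

lemma reflect_self: "\<alpha> \<in> R \<Longrightarrow> reflect \<alpha> \<alpha> = - \<alpha>"
  using cartan_self[of \<alpha>] by (simp add: reflect_def fun_eq_iff)

lemma reflect_V [simp, intro]: "\<alpha> \<in> V \<Longrightarrow> x \<in> V \<Longrightarrow> reflect \<alpha> x \<in> V"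
  by (simp add: reflect_def)

lemma minus_R: "\<alpha> \<in> R \<Longrightarrow> - \<alpha> \<in> R"
  using reflect_in[of \<alpha> \<alpha>] reflect_self[of \<alpha>] by simp

lemma minus_D: "\<alpha> \<in> D \<Longrightarrow> - \<alpha> \<in> D"
  using minus_R[of \<alpha>] zero_in_D by (cases "\<alpha> = 0") auto

lemma cartan_separates:
  assumes "x \<in> Q" and "\<And>\<alpha>. \<alpha> \<in> R \<Longrightarrow> cartan x \<alpha> = 0" shows "x = 0"
proof -
  have "Q \<subseteq> {y. rdot x y = 0}"
  proof (rule subgroup_gen_least)
    show "D \<subseteq> {y. rdot x y = 0}"
    proof
      fix y assume "y \<in> D"
      then show "y \<in> {y. rdot x y = 0}"
        using assms cartan_eq_0_iff[of x y] by (cases "y = 0") (auto simp: rdot_right)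
    qed
  qed (auto simp: rdot_right)
  then show ?thesis using assms(1) rdot_pos[of x] by force
qed

section \<open>Indivisible roots and the reflections permuting them\<close>

lemma not_four_times: assumes "\<alpha> \<in> R" shows "rscale 4 \<alpha> \<notin> R"
proof
  assume *: "rscale 4 \<alpha> \<in> R"
  have "cartan \<alpha> (rscale 4 \<alpha>) = 1/2" using assms rdot_pos[of \<alpha>]
    by (auto simp: cartan_def rdot_left rdot_right)
  moreover have "1/2 \<notin> (\<int>::real set)"
    using fraction_not_in_Ints[of 2 1, where 'a = real] by simp
  ultimately show False using cartan_int[OF * assms] by metis
qed

lemma J_subset: "\<alpha> \<in> J \<Longrightarrow> \<alpha> \<in> R" by (auto simp: indivisible_roots_def)

lemma indivisible_or_double: assumes "\<alpha> \<in> R" obtains "\<alpha> \<in> J" | \<delta> where "\<delta> \<in> J" "\<alpha> = rscale 2 \<delta>"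
proof (cases "\<alpha> \<in> J")
  case False
  then obtain \<delta> where \<delta>: "\<delta> \<in> R" "\<alpha> = rscale 2 \<delta>" using assms by (auto simp: indivisible_roots_def)
  have "\<delta> \<in> J"
  proof (rule ccontr)
    assume "\<delta> \<notin> J"
    then obtain \<epsilon> where "\<epsilon> \<in> R" "\<delta> = rscale 2 \<epsilon>" using \<delta> by (auto simp: indivisible_roots_def)
    moreover have "rscale 2 (rscale 2 \<epsilon>) = rscale 4 \<epsilon>" by (auto simp: fun_eq_iff)
    ultimately show False using not_four_times[of \<epsilon>] \<delta> assms by auto
  qed
  then show thesis using \<delta> that by blast
qed (use that in blast)

lemma finite_J: "finite J" using finite_R by (auto simp: indivisible_roots_def)

lemma J_nonempty: "J \<noteq> {}"
  using R_nonempty indivisible_or_double by blast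

lemma reflect_linear:
  assumes "x \<in> V"
  shows "reflect \<gamma> (rscale c x) = rscale c (reflect \<gamma> x)"
  using assms by (simp add: reflect_def cartan_left fun_eq_iff algebra_simps)

lemma reflect_reflect: assumes "\<gamma> \<in> R" "x \<in> V" shows "reflect \<gamma> (reflect \<gamma> x) = x"
  using assms by (simp add: reflect_def cartan_left cartan_self fun_eq_iff)

lemma rdot_reflect: assumes "\<gamma> \<in> V" "x \<in> V" "y \<in> V" shows "rdot (reflect \<gamma> x) y = rdot x (reflect \<gamma> y)"
  using assms rdot_commute[of \<gamma> y]
  by (simp add: reflect_def rdot_left rdot_right cartan_def rdot_commute)

lemma reflect_J: assumes "\<gamma> \<in> R" "\<delta> \<in> J" shows "reflect \<gamma> \<delta> \<in> J"
proof (rule ccontr)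
  have R: "reflect \<gamma> \<delta> \<in> R" using assms J_subset reflect_in by auto
  assume "reflect \<gamma> \<delta> \<notin> J"
  then obtain \<epsilon> where \<epsilon>: "\<epsilon> \<in> R" "reflect \<gamma> \<delta> = rscale 2 \<epsilon>" using R by (auto simp: indivisible_roots_def)
  have "\<delta> = reflect \<gamma> (reflect \<gamma> \<delta>)" using reflect_reflect[of \<gamma> \<delta>] assms J_subset[of \<delta>] by simp
  also have "\<dots> = reflect \<gamma> (rscale 2 \<epsilon>)" by (simp only: \<epsilon>(2))
  also have "\<dots> = rscale 2 (reflect \<gamma> \<epsilon>)" using \<epsilon> by (intro reflect_linear) auto
  finally show False using assms(2) reflect_in[OF assms(1) \<epsilon>(1)] unfolding indivisible_roots_def by blast
qed

lemma bij_reflect: assumes "\<gamma> \<in> R" shows "bij_betw (reflect \<gamma>) J J"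
  by (rule bij_betw_byWitness[where f' = "reflect \<gamma>"])
    (use reflect_J[OF assms] reflect_reflect[OF assms] J_subset in auto)

text \<open>Irreducibility is a statement about all nonzero roots. Enlarging X by those doubles of
  its members that are roots gives a set orthogonal to its complement, so a proper X would split the
  root system.\<close>

lemma J_connected:
  assumes "X \<subseteq> J" "X \<noteq> {}" and cl: "\<And>\<beta> \<gamma>. \<beta> \<in> X \<Longrightarrow> \<gamma> \<in> J \<Longrightarrow> rdot \<beta> \<gamma> \<noteq> 0 \<Longrightarrow> \<gamma> \<in> X"
  shows "X = J"
proof (rule ccontr)
  assume "X \<noteq> J"
  define A where "A = {\<alpha> \<in> R. \<alpha> \<in> X \<or> (\<exists>\<delta>\<in>X. \<alpha> = rscale 2 \<delta>)}"
  have XA: "X \<subseteq> A" using assms(1) J_subset by (auto simp: A_def)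
  obtain \<gamma> where \<gamma>: "\<gamma> \<in> J" "\<gamma> \<notin> X" using \<open>X \<noteq> J\<close> assms(1) by auto
  have "\<gamma> \<notin> A" using \<gamma> assms(1) J_subset unfolding A_def indivisible_roots_def by blast
  have "rdot a b = 0" if a: "a \<in> A" and b: "b \<in> R - A" for a b
  proof -
    obtain \<beta> where \<beta>: "\<beta> \<in> X" "a = \<beta> \<or> a = rscale 2 \<beta>" using a by (auto simp: A_def)
    have "b \<in> R" using b by simp
    then obtain \<delta> where \<delta>: "\<delta> \<in> J" "b = \<delta> \<or> b = rscale 2 \<delta>" using indivisible_or_double by metis
    have "\<delta> \<notin> X" using \<delta> b by (auto simp: A_def)
    then have "rdot \<beta> \<delta> = 0" using cl \<beta> \<delta> by blast
    moreover have "\<beta> \<in> V" using \<beta>(1) assms(1) J_subset by blast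
    ultimately show ?thesis using \<beta>(2) \<delta>(2) by (auto simp: rdot_left rdot_right)
  qed
  moreover have "A \<union> (R - A) = R" "A \<inter> (R - A) = {}" "A \<noteq> {}" "R - A \<noteq> {}"
    using XA assms(2) J_subset[OF \<gamma>(1)] \<open>\<gamma> \<notin> A\<close> by (auto simp: A_def)
  ultimately show False
    using irr unfolding irred_finite_root_system_def irreducible_root_system_def by blast
qed

lemma Q_eq_J: "Q = subgroup_gen J"
proof
  show "subgroup_gen J \<subseteq> Q" by (rule subgroup_gen_mono) (use J_subset in \<open>auto intro: subgroup_gen_base\<close>)
  have "\<alpha> \<in> subgroup_gen J" if "\<alpha> \<in> D" for \<alpha>
  proof (cases "\<alpha> = 0")
    case True then show ?thesis using subgroup_gen_zero by simp
  next
    case False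
    then have "\<alpha> \<in> R" using that by simp
    then show ?thesis
    proof (cases rule: indivisible_or_double)
      case (2 \<delta>)
      have "rscale 2 \<delta> = \<delta> + \<delta>" by (simp add: fun_eq_iff)
      then show ?thesis using 2 subgroup_gen_add[of \<delta> J \<delta>] subgroup_gen_base[of \<delta> J] by simp
    qed (auto intro: subgroup_gen_base)
  qed
  then show "Q \<subseteq> subgroup_gen J" by (intro subgroup_gen_mono) auto
qed

text \<open>The standard averaged form. The sum runs over \<open>J\<close>, which reflections
  permute, and thus the form is invariant under them.\<close>

definition "form x y = (\<Sum>\<delta>\<in>J. rdot x \<delta> * rdot y \<delta>)"

lemma form_reflect: assumes "\<gamma> \<in> R" "x \<in> V" "y \<in> V" shows "form (reflect \<gamma> x) (reflect \<gamma> y) = form x y"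
proof -
  have "form (reflect \<gamma> x) (reflect \<gamma> y) = (\<Sum>\<delta>\<in>J. rdot x (reflect \<gamma> \<delta>) * rdot y (reflect \<gamma> \<delta>))"
    unfolding form_def by (intro sum.cong refl) (use assms rdot_reflect J_subset in auto)
  also have "\<dots> = form x y" unfolding form_def
    by (rule sum.reindex_bij_betw[OF bij_reflect[OF assms(1)], of "\<lambda>\<delta>. rdot x \<delta> * rdot y \<delta>"])
  finally show ?thesis .
qed

text \<open>Reflection in \<gamma> sends \<gamma> to its negative; applying invariance to the pair
  (\<gamma>, x) and expanding the reflected x gives the identity. Every invariant bilinear form has
  this property.\<close>

lemma form_root: assumes "\<gamma> \<in> R" "x \<in> V" shows "2 * form \<gamma> x = cartan x \<gamma> * form \<gamma> \<gamma>"
proof -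
  have "form \<gamma> x = form (- \<gamma>) (reflect \<gamma> x)" using form_reflect[of \<gamma> \<gamma> x] reflect_self[of \<gamma>] assms by simp
  also have "\<dots> = - form \<gamma> x + cartan x \<gamma> * form \<gamma> \<gamma>"
    unfolding form_def reflect_def using assms
    by (simp add: rdot_left sum_distrib_left algebra_simps sum.distrib sum_negf sum_subtractf)
  finally show ?thesis by simp
qed

text \<open>Reflection invariance makes the form proportional to the inner product at each root;
  nonorthogonal roots have the same constant, so by irreducibility there is only one.\<close>
lemma form_proportional: obtains k where "k > 0" "\<And>\<gamma>. \<gamma> \<in> J \<Longrightarrow> form \<gamma> \<gamma> = k * rdot \<gamma> \<gamma>"
proof -
  obtain \<gamma>0 where \<gamma>0: "\<gamma>0 \<in> J" using J_nonempty by auto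
  have V: "\<delta> \<in> V" "\<delta> \<noteq> 0" "\<delta> \<in> R" if "\<delta> \<in> J" for \<delta> using J_subset that by auto
  define k where "k = form \<gamma>0 \<gamma>0 / rdot \<gamma>0 \<gamma>0"
  have p: "rdot \<gamma>0 \<gamma>0 > 0" using V[OF \<gamma>0] rdot_pos by auto
  have "form \<gamma>0 \<gamma>0 > 0" unfolding form_def
    by (rule sum_pos2[OF finite_J \<gamma>0]) (use p in auto)
  then have k: "k > 0" using p by (simp add: k_def)
  have "{\<gamma> \<in> J. form \<gamma> \<gamma> = k * rdot \<gamma> \<gamma>} = J"
  proof (rule J_connected)
    show "{\<gamma> \<in> J. form \<gamma> \<gamma> = k * rdot \<gamma> \<gamma>} \<noteq> {}" using \<gamma>0 p by (auto simp: k_def)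
  next
    fix \<beta> \<gamma> assume b: "\<beta> \<in> {\<gamma> \<in> J. form \<gamma> \<gamma> = k * rdot \<gamma> \<gamma>}" and g: "\<gamma> \<in> J" and n: "rdot \<beta> \<gamma> \<noteq> 0"
    have s: "rdot \<gamma> \<beta> = rdot \<beta> \<gamma>" using V b g rdot_commute by auto
    have f: "form \<gamma> \<beta> = form \<beta> \<gamma>" by (simp add: form_def mult.commute)
    have 1: "form \<beta> \<gamma> = k * rdot \<beta> \<gamma>"
      using form_root[of \<beta> \<gamma>] b V g rdot_pos[of \<beta>] by (auto simp: cartan_def s)
    have "2 * (k * rdot \<beta> \<gamma>) = 2 * rdot \<beta> \<gamma> / rdot \<gamma> \<gamma> * form \<gamma> \<gamma>"
      using form_root[of \<gamma> \<beta>] b V g f 1 by (auto simp: cartan_def)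
    then have "form \<gamma> \<gamma> = k * rdot \<gamma> \<gamma>" using n rdot_pos[of \<gamma>] V[OF g] by (auto simp: field_simps)
    then show "\<gamma> \<in> {\<gamma> \<in> J. form \<gamma> \<gamma> = k * rdot \<gamma> \<gamma>}" using g by simp
  qed auto
  then show thesis using k that by blast
qed

text \<open>The additive map \<open>P x = \<Sum>\<delta>. (x, \<delta>) p \<delta>\<close> restricts to a nonzero multiple of \<open>p\<close>: reindexing the sum
  by the reflection in \<open>\<gamma>\<close> gives \<open>P \<gamma> = - P \<gamma> + 2 k p \<gamma>\<close>, where \<open>k\<close> is the constant of the previous lemma.\<close>
lemma reflection_equivariant_extends:
  fixes p :: "rvec \<Rightarrow> nat \<Rightarrow> int"
  assumes p: "\<And>\<alpha> \<beta> m. \<alpha> \<in> J \<Longrightarrow> \<beta> \<in> J \<Longrightarrow> real_of_int m = cartan \<beta> \<alpha> \<Longrightarrow> p (reflect \<alpha> \<beta>) = p \<beta> - of_int m * p \<alpha>"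
    and y: "(0, y) \<in> subgroup_gen {(\<alpha>, p \<alpha>) | \<alpha>. \<alpha> \<in> J}"
  shows "y = 0"
proof -
  obtain k where k: "k > 0" "\<And>\<gamma>. \<gamma> \<in> J \<Longrightarrow> form \<gamma> \<gamma> = k * rdot \<gamma> \<gamma>" by (rule form_proportional) blast
  define P where "P i x = (\<Sum>\<delta>\<in>J. rdot x \<delta> * of_int (p \<delta> i))" for i x
  have P: "P i \<gamma> = k * of_int (p \<gamma> i)" if \<gamma>: "\<gamma> \<in> J" for i \<gamma>
  proof -
    have V: "\<gamma> \<in> R" "\<gamma> \<in> V" "\<gamma> \<noteq> 0" using J_subset[OF \<gamma>] by auto
    have "P i \<gamma> = (\<Sum>\<delta>\<in>J. rdot \<gamma> (reflect \<gamma> \<delta>) * of_int (p (reflect \<gamma> \<delta>) i))"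
      unfolding P_def
      by (rule sum.reindex_bij_betw[OF bij_reflect[OF V(1)], of "\<lambda>\<delta>. rdot \<gamma> \<delta> * of_int (p \<delta> i)", symmetric])
    also have "\<dots> = (\<Sum>\<delta>\<in>J. - rdot \<gamma> \<delta> * of_int (p \<delta> i) + 2 / rdot \<gamma> \<gamma> * of_int (p \<gamma> i) * (rdot \<gamma> \<delta> * rdot \<gamma> \<delta>))"
    proof (intro sum.cong refl)
      fix \<delta> assume \<delta>: "\<delta> \<in> J"
      have V': "\<delta> \<in> R" "\<delta> \<in> V" using J_subset[OF \<delta>] by auto
      obtain m where m: "real_of_int m = cartan \<delta> \<gamma>" using cartan_int[OF V(1) V'(1)] Ints_cases by metis
      have 1: "rdot \<gamma> (reflect \<gamma> \<delta>) = - rdot \<gamma> \<delta>"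
        using rdot_reflect[of \<gamma> \<gamma> \<delta>] reflect_self[OF V(1)] rdot_left(4)[OF V(2)] V V' by simp
      have h: "real_of_int (p (reflect \<gamma> \<delta>) i) = p \<delta> i - cartan \<delta> \<gamma> * p \<gamma> i"
        using p[OF \<gamma> \<delta> m] m[symmetric] by simp
      then show "rdot \<gamma> (reflect \<gamma> \<delta>) * of_int (p (reflect \<gamma> \<delta>) i) =
        - rdot \<gamma> \<delta> * of_int (p \<delta> i) + 2 / rdot \<gamma> \<gamma> * of_int (p \<gamma> i) * (rdot \<gamma> \<delta> * rdot \<gamma> \<delta>)"
        unfolding 1 h using rdot_commute[OF V(2) V'(2)] by (simp add: cartan_def algebra_simps)
    qed
    also have "\<dots> = - P i \<gamma> + 2 / rdot \<gamma> \<gamma> * of_int (p \<gamma> i) * form \<gamma> \<gamma>"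
      by (simp add: P_def form_def sum.distrib sum_negf sum_subtractf sum_distrib_left)
    finally show ?thesis using k(2)[OF \<gamma>] rdot_pos[OF V(2,3)] by simp
  qed
  \<comment> \<open>The relation \<open>P i x = k * y i\<close> holds on the generators and is
    additive in the pair; at x = 0 it forces y = 0, as k is positive.\<close>
  have "x \<in> V \<and> (\<forall>i. P i x = k * of_int (y i))" if "(x, y) \<in> subgroup_gen {(\<alpha>, p \<alpha>) | \<alpha>. \<alpha> \<in> J}" for x y
    using that
  proof (induction "(x, y)" arbitrary: x y rule: subgroup_gen_induct)
    case base then show ?case using P J_subset by auto
  next
    case zero
    then have xy: "x = 0" "y = 0" by (simp_all add: zero_prod_def)
    have "x \<in> V" unfolding xy by (rule V_intros)
    moreover have "P i x = k * of_int (y i)" for i unfolding xy by (simp add: P_def rdot_def)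
    ultimately show ?case by blast
  next
    case (add p q)
    then show ?case by (cases p; cases q) (force simp: P_def rdot_left algebra_simps sum.distrib)
  next
    case (minus p)
    then show ?case by (cases p) (force simp: P_def rdot_left algebra_simps sum_negf)
  qed
  from this[OF y] show ?thesis using k by (auto simp: P_def rdot_def fun_eq_iff)
qed

end

section \<open>Degree functions compatible with reflections\<close>

text \<open>An abstraction free of Lie algebras: \<open>S \<alpha>\<close> stands for the set of
  degrees occurring at the root \<alpha> in the first grading, and
  \<open>\<sigma> \<alpha> l\<close> for the corresponding degree in the second one, corrected so
  that it vanishes at degree 0 of every indivisible root.\<close>

locale reflection_support = irred_roots +
  fixes S :: "rvec \<Rightarrow> (nat \<Rightarrow> int) set" and \<sigma> :: "rvec \<Rightarrow> (nat \<Rightarrow> int) \<Rightarrow> nat \<Rightarrow> int"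
  assumes S_zero: "\<alpha> \<in> J \<Longrightarrow> 0 \<in> S \<alpha>"
    and S_reflect: "\<lbrakk>\<alpha> \<in> R; \<beta> \<in> R; l \<in> S \<alpha>; \<mu> \<in> S \<beta>; real_of_int m = cartan \<beta> \<alpha>\<rbrakk> \<Longrightarrow>
      \<mu> - of_int m * l \<in> S (reflect \<alpha> \<beta>) \<and>
      \<sigma> (reflect \<alpha> \<beta>) (\<mu> - of_int m * l) = \<sigma> \<beta> \<mu> - of_int m * \<sigma> \<alpha> l"
    and \<sigma>_zero: "\<alpha> \<in> J \<Longrightarrow> \<sigma> \<alpha> 0 = 0"
    and \<sigma>_inj: "\<alpha> \<in> R \<Longrightarrow> inj_on (\<sigma> \<alpha>) (S \<alpha>)"
begin

text \<open>Reflection in an indivisible root can be performed at degree 0, where it moves no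
  degrees at all.\<close>

lemma S_reflect_J:
  assumes "\<delta> \<in> J" "\<beta> \<in> R" "\<mu> \<in> S \<beta>"
  shows "\<mu> \<in> S (reflect \<delta> \<beta>)" "\<sigma> (reflect \<delta> \<beta>) \<mu> = \<sigma> \<beta> \<mu>"
proof -
  have R: "\<delta> \<in> R" using J_subset assms by auto
  obtain m where m: "real_of_int m = cartan \<beta> \<delta>" using cartan_int[OF R assms(2)] Ints_cases by metis
  show "\<mu> \<in> S (reflect \<delta> \<beta>)" "\<sigma> (reflect \<delta> \<beta>) \<mu> = \<sigma> \<beta> \<mu>"
    using S_reflect[OF R assms(2) S_zero[OF assms(1)] assms(3) m] \<sigma>_zero[OF assms(1)]
    by (simp_all only: mult_zero_right diff_zero)
qed

lemma indivisible_reflection: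
  assumes "\<alpha> \<in> R"
  obtains \<delta> where "\<delta> \<in> J" "\<And>\<beta>. \<beta> \<in> V \<Longrightarrow> reflect \<delta> \<beta> = reflect \<alpha> \<beta>" "\<exists>c. c > 0 \<and> \<alpha> = rscale c \<delta>"
  using assms
proof (cases rule: indivisible_or_double)
  case 1 then show ?thesis using that[of \<alpha>] by (metis rscale_simps(1) zero_less_one)
next
  case (2 \<delta>)
  have V: "\<delta> \<in> V" using J_subset 2 by blast
  have "reflect \<alpha> \<beta> = reflect \<delta> \<beta>" for \<beta>
    unfolding 2 reflect_def cartan_def using V by (auto simp: fun_eq_iff rdot_left rdot_right)
  then show ?thesis using that[of \<delta>] 2 by (metis zero_less_numeral)
qed

text \<open>Reflecting \<alpha> in itself at degree l, with Cartan integer 2, turns l into -l at the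
  root -\<alpha>. The same reflection at degree 0 returns to \<alpha> without changing the
  degree.\<close>

lemma S_minus:
  assumes "\<alpha> \<in> R" "l \<in> S \<alpha>" shows "- l \<in> S \<alpha>" "\<sigma> \<alpha> (- l) = - \<sigma> \<alpha> l"
proof -
  obtain \<delta> where \<delta>: "\<delta> \<in> J" "\<And>\<beta>. \<beta> \<in> V \<Longrightarrow> reflect \<delta> \<beta> = reflect \<alpha> \<beta>"
    using indivisible_reflection[OF assms(1)] by blast
  have "real_of_int 2 = cartan \<alpha> \<alpha>" using cartan_self[OF assms(1)] by simp
  from S_reflect[OF assms(1,1,2,2) this]
  have 1: "- l \<in> S (- \<alpha>)" "\<sigma> (- \<alpha>) (- l) = - \<sigma> \<alpha> l"
    by (simp_all add: reflect_self[OF assms(1)])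
  have "reflect \<delta> (- \<alpha>) = \<alpha>"
    using \<delta>(2)[of "- \<alpha>"] reflect_self[OF minus_R[OF assms(1)]] assms(1) reflect_reflect[of \<alpha> \<alpha>] reflect_self[of \<alpha>] by simp
  then show "- l \<in> S \<alpha>" "\<sigma> \<alpha> (- l) = - \<sigma> \<alpha> l"
    using S_reflect_J[OF \<delta>(1) minus_R[OF assms(1)] 1(1)] 1(2) by auto
qed

text \<open>Two parallel reflections compose to a translation: first in \<alpha> at degree l, then
  back at degree 0 through the indivisible root on the same line.\<close>

lemma S_shift:
  assumes "\<alpha> \<in> R" "l \<in> S \<alpha>" "\<beta> \<in> J" "\<mu> \<in> S \<beta>" "real_of_int m = cartan \<beta> \<alpha>"
  shows "\<mu> - of_int m * l \<in> S \<beta>" "\<sigma> \<beta> (\<mu> - of_int m * l) = \<sigma> \<beta> \<mu> - of_int m * \<sigma> \<alpha> l"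
proof -
  obtain \<delta> where \<delta>: "\<delta> \<in> J" "\<And>\<beta>. \<beta> \<in> V \<Longrightarrow> reflect \<delta> \<beta> = reflect \<alpha> \<beta>"
    using indivisible_reflection[OF assms(1)] by blast
  have \<beta>: "\<beta> \<in> R" "\<beta> \<in> V" using J_subset[OF assms(3)] by auto
  note 1 = S_reflect[OF assms(1) \<beta>(1) assms(2,4,5)]
  have "reflect \<delta> (reflect \<alpha> \<beta>) = \<beta>" using \<delta> assms(1) \<beta> reflect_reflect[of \<alpha> \<beta>] by simp
  then show "\<mu> - of_int m * l \<in> S \<beta>" "\<sigma> \<beta> (\<mu> - of_int m * l) = \<sigma> \<beta> \<mu> - of_int m * \<sigma> \<alpha> l"
    using S_reflect_J[OF \<delta>(1) reflect_in[OF assms(1) \<beta>(1)] conjunct1[OF 1]] 1 by auto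
qed

text \<open>Pairs of translations, one of the degree set and one of the values, that \<sigma>
  intertwines. Membership is an equivalence and not an implication, which makes these pairs a
  group.\<close>

definition "shifts \<beta> = {(x, y). \<forall>\<mu>. (\<mu> \<in> S \<beta> \<longleftrightarrow> \<mu> + x \<in> S \<beta>) \<and> (\<mu> \<in> S \<beta> \<longrightarrow> \<sigma> \<beta> (\<mu> + x) = \<sigma> \<beta> \<mu> + y)}"

lemma shifts_add: "(x, y) \<in> shifts \<beta> \<Longrightarrow> (x', y') \<in> shifts \<beta> \<Longrightarrow> (x + x', y + y') \<in> shifts \<beta>"
  unfolding shifts_def by (simp add: add.assoc[symmetric])

lemma shifts_minus: assumes "(x, y) \<in> shifts \<beta>" shows "(- x, - y) \<in> shifts \<beta>"
proof -
  have "(\<mu> \<in> S \<beta> \<longleftrightarrow> \<mu> - x \<in> S \<beta>) \<and> (\<mu> \<in> S \<beta> \<longrightarrow> \<sigma> \<beta> (\<mu> - x) = \<sigma> \<beta> \<mu> - y)" for \<mu>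
    using assms[unfolded shifts_def, simplified, rule_format, of "\<mu> - x"] by auto
  then show ?thesis by (simp add: shifts_def)
qed

lemma shifts_zero: "(0, 0) \<in> shifts \<beta>"
  by (simp add: shifts_def)

lemma shifts_times: assumes "(x, y) \<in> shifts \<beta>" shows "(of_int k * x, of_int k * y) \<in> shifts \<beta>"
proof (induction k rule: int_induct[of _ 0])
  case base show ?case using shifts_zero by (simp only: of_int_0 mult_zero_left)
next
  case (step1 i) then show ?case using shifts_add[OF step1(2) assms]
    by (simp only: distrib_right of_int_add of_int_1 mult_1_left)
next
  case (step2 i) then show ?case using shifts_add[OF step2(2) shifts_minus[OF assms]]
    by (simp only: left_diff_distrib of_int_diff of_int_1 mult_1_left add_uminus_conv_diff)
qed

lemma shifts_root:
  assumes "\<alpha> \<in> R" "l \<in> S \<alpha>" "\<beta> \<in> J" "real_of_int m = cartan \<beta> \<alpha>"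
  shows "(of_int m * l, of_int m * \<sigma> \<alpha> l) \<in> shifts \<beta>"
proof -
  have down: "\<mu> - of_int m * l \<in> S \<beta>" "\<sigma> \<beta> (\<mu> - of_int m * l) = \<sigma> \<beta> \<mu> - of_int m * \<sigma> \<alpha> l" if "\<mu> \<in> S \<beta>" for \<mu>
    using S_shift[OF assms(1-3) that assms(4)] by auto
  have up: "\<mu> + of_int m * l \<in> S \<beta>" "\<sigma> \<beta> (\<mu> + of_int m * l) = \<sigma> \<beta> \<mu> + of_int m * \<sigma> \<alpha> l" if "\<mu> \<in> S \<beta>" for \<mu>
    using S_shift[OF assms(1) S_minus(1)[OF assms(1,2)] assms(3) that assms(4)] S_minus(2)[OF assms(1,2)]
    by (simp_all only: mult_minus_right diff_minus_eq_add)
  show ?thesis unfolding shifts_def mem_Collect_eq prod.case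
  proof (intro allI conjI iffI impI)
    fix \<mu> assume "\<mu> + of_int m * l \<in> S \<beta>"
    from down(1)[OF this] show "\<mu> \<in> S \<beta>" by (simp only: add_diff_cancel_right')
  qed (use up in blast)+
qed

text \<open>Translations up to a nonzero integer multiple: passing from \<open>\<beta>\<close> to a nonorthogonal \<open>\<gamma>\<close> multiplies
  a translation by a Cartan integer.\<close>
definition "qshifts \<beta> = {(x, y). \<exists>K::int. K \<noteq> 0 \<and> (of_int K * x, of_int K * y) \<in> shifts \<beta>}"

lemma qshifts_add: assumes "(x, y) \<in> qshifts \<beta>" "(x', y') \<in> qshifts \<beta>" shows "(x + x', y + y') \<in> qshifts \<beta>"
proof -
  obtain K K' :: int where K: "K \<noteq> 0" "(of_int K * x, of_int K * y) \<in> shifts \<beta>"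
    "K' \<noteq> 0" "(of_int K' * x', of_int K' * y') \<in> shifts \<beta>" using assms by (auto simp: qshifts_def)
  have "(of_int (K * K') * (x + x'), of_int (K * K') * (y + y')) \<in> shifts \<beta>"
    using shifts_add[OF shifts_times[OF K(2), of K'] shifts_times[OF K(4), of K]]
    by (simp only: of_int_mult distrib_left mult_ac)
  then show ?thesis using K by (auto simp: qshifts_def intro!: exI[of _ "K * K'"])
qed

lemma qshifts_minus: assumes "(x, y) \<in> qshifts \<beta>" shows "(- x, - y) \<in> qshifts \<beta>"
  using assms shifts_minus unfolding qshifts_def by fastforce

lemma qshifts_zero: "(0, 0) \<in> qshifts \<beta>"
  using shifts_zero unfolding qshifts_def by (auto intro!: exI[of _ 1])

text \<open>Translating degree 0 of \<beta> shows that the multiple \<open>K * x\<close> is itself a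
  degree of \<beta>, with value \<open>K * y\<close>. Hence \<beta> can be used as the reflecting
  root in \<open>shifts_root\<close>, and the new factor is K times a nonzero Cartan
  integer.\<close>

lemma qshifts_le: 
  assumes "\<beta> \<in> J" "\<gamma> \<in> J" "rdot \<beta> \<gamma> \<noteq> 0" shows "qshifts \<beta> \<subseteq> qshifts \<gamma>"
proof
  fix p assume "p \<in> qshifts \<beta>"
  then obtain x y K where p: "p = (x, y)" "K \<noteq> (0::int)" "(of_int K * x, of_int K * y) \<in> shifts \<beta>"
    by (auto simp: qshifts_def)
  have R: "\<beta> \<in> R" "\<gamma> \<in> R" "\<beta> \<in> V" "\<gamma> \<in> V" using J_subset assms by auto
  obtain m where m: "real_of_int m = cartan \<gamma> \<beta>" using cartan_int[OF R(1,2)] Ints_cases by metis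
  have "m \<noteq> 0" using m assms(3) cartan_eq_0_iff[of \<gamma> \<beta>] R rdot_commute[of \<beta> \<gamma>] by auto
  have "\<forall>\<mu>. \<mu> \<in> S \<beta> \<longrightarrow> \<mu> + of_int K * x \<in> S \<beta> \<and> \<sigma> \<beta> (\<mu> + of_int K * x) = \<sigma> \<beta> \<mu> + of_int K * y"
    using p(3) unfolding shifts_def by blast
  from this[rule_format, OF S_zero[OF assms(1)]] \<sigma>_zero[OF assms(1)]
  have "of_int K * x \<in> S \<beta>" "\<sigma> \<beta> (of_int K * x) = of_int K * y" by (simp_all only: add_0_left)
  with shifts_root[OF R(1) _ assms(2) m, of "of_int K * x"]
  have "(of_int (m * K) * x, of_int (m * K) * y) \<in> shifts \<gamma>" by (simp only: of_int_mult mult.assoc)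
  then show "p \<in> qshifts \<gamma>" using p \<open>m \<noteq> 0\<close> unfolding qshifts_def by (auto intro!: exI[of _ "m * K"])
qed

lemma qshifts_const: assumes "\<beta> \<in> J" "\<gamma> \<in> J" shows "qshifts \<beta> \<subseteq> qshifts \<gamma>"
proof -
  have "{\<gamma> \<in> J. qshifts \<beta> \<subseteq> qshifts \<gamma>} = J"
    by (rule J_connected) (use assms qshifts_le in blast)+
  then show ?thesis using assms by blast
qed

text \<open>The indivisible root \<delta> on the ray of \<alpha> is not orthogonal to \<alpha>, so a
  nonzero multiple of l translates the degrees of \<delta>; connectedness carries this over to every
  \<gamma>.\<close>

lemma qshifts_root: assumes "\<alpha> \<in> R" "l \<in> S \<alpha>" "\<gamma> \<in> J" shows "(l, \<sigma> \<alpha> l) \<in> qshifts \<gamma>"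
proof -
  obtain \<delta> c where \<delta>: "\<delta> \<in> J" "c > 0" "\<alpha> = rscale c \<delta>"
    using indivisible_reflection[OF assms(1)] by metis
  have R: "\<delta> \<in> R" "\<delta> \<in> V" "\<delta> \<noteq> 0" using J_subset[OF \<delta>(1)] by auto
  obtain m where m: "real_of_int m = cartan \<delta> \<alpha>" using cartan_int[OF assms(1) R(1)] Ints_cases by metis
  have "rdot \<delta> \<alpha> \<noteq> 0" using \<delta> rdot_pos[OF R(2,3)] by (simp add: rdot_right)
  then have "m \<noteq> 0" using m cartan_eq_0_iff[OF R(2) assms(1)] by auto
  then have "(l, \<sigma> \<alpha> l) \<in> qshifts \<delta>"
    using shifts_root[OF assms(1,2) \<delta>(1) m] by (auto simp: qshifts_def)
  then show ?thesis using qshifts_const[OF \<delta>(1) assms(3)] by auto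
qed

lemma of_int_times_eq_0: "of_int K * (x :: nat \<Rightarrow> int) = 0 \<longleftrightarrow> K = 0 \<or> x = 0"
  by (auto simp: fun_eq_iff)

text \<open>All of \<open>T\<close> consists of translations, up to a factor, of one fixed \<beta>.
  Moving degree 0 of \<beta> by such a pair compares \<open>K * x\<close> with \<open>K * y\<close>
  inside a single injective map, and K cancels because the groups are torsion-free. The two claims
  are the hypotheses of \<open>graph_iso\<close>.\<close>

lemma degree_graph:
  defines "T \<equiv> {(l, \<sigma> \<alpha> l) | \<alpha> l. \<alpha> \<in> R \<and> l \<in> S \<alpha>}"
  shows "(0, y) \<in> subgroup_gen T \<Longrightarrow> y = 0" and "(x, 0) \<in> subgroup_gen T \<Longrightarrow> x = 0"
proof -
  obtain \<beta> where \<beta>: "\<beta> \<in> J" using J_nonempty by auto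
  have sub: "subgroup_gen T \<subseteq> qshifts \<beta>"
    by (rule subgroup_gen_least)
      (auto simp: T_def zero_prod_def plus_prod_def uminus_prod_def intro: qshifts_root[OF _ _ \<beta>] qshifts_zero qshifts_add qshifts_minus)
  have key: "\<exists>K. K \<noteq> 0 \<and> of_int K * x \<in> S \<beta> \<and> \<sigma> \<beta> (of_int K * x) = of_int K * y"
    if xy: "(x, y) \<in> subgroup_gen T" for x y
  proof -
    obtain K where K: "K \<noteq> 0" "(of_int K * x, of_int K * y) \<in> shifts \<beta>" using xy sub unfolding qshifts_def by auto
    have "\<forall>\<mu>. \<mu> \<in> S \<beta> \<longrightarrow> \<mu> + of_int K * x \<in> S \<beta> \<and> \<sigma> \<beta> (\<mu> + of_int K * x) = \<sigma> \<beta> \<mu> + of_int K * y"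
      using K(2) unfolding shifts_def by blast
    from this[rule_format, OF S_zero[OF \<beta>]] \<sigma>_zero[OF \<beta>] K(1) show ?thesis by (simp only: add_0_left) blast
  qed
  show "y = 0" if z: "(0, y) \<in> subgroup_gen T"
  proof -
    obtain K where K: "K \<noteq> 0" "\<sigma> \<beta> (of_int K * 0) = of_int K * y" using key[OF z] by blast
    then have "of_int K * y = 0" using \<sigma>_zero[OF \<beta>] by (simp only: mult_zero_right)
    then show ?thesis using K of_int_times_eq_0 by blast
  qed
  show "x = 0" if z: "(x, 0) \<in> subgroup_gen T"
  proof -
    obtain K where K: "K \<noteq> 0" "of_int K * x \<in> S \<beta>" "\<sigma> \<beta> (of_int K * x) = of_int K * 0"
      using key[OF z] by blast
    then have "\<sigma> \<beta> (of_int K * x) = \<sigma> \<beta> 0" using \<sigma>_zero[OF \<beta>] by (simp only: mult_zero_right)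
    then have "of_int K * x = 0"
      using inj_onD[OF \<sigma>_inj[OF J_subset[OF \<beta>]]] K(2) S_zero[OF \<beta>] by blast
    then show "x = 0" using K of_int_times_eq_0 by blast
  qed
qed

end

section \<open>Lie tori\<close>

locale lie_torus_on =
  fixes sc :: "'k::field_char_0 \<Rightarrow> 'a::ab_group_add \<Rightarrow> 'a" and br :: "'a \<Rightarrow> 'a \<Rightarrow> 'a"
    and D :: "rvec set" and n :: nat and G :: "rvec \<Rightarrow> (nat \<Rightarrow> int) \<Rightarrow> 'a set"
  assumes torus: "lie_torus sc br D n G"
begin

sublocale irred_roots D
  using torus by unfold_locales (simp add: lie_torus_def)

sublocale vector_space sc
  using torus by (simp add: lie_torus_def lie_algebra_def)

lemma grading: "is_grading sc br Q (Zn n) G"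
  using torus by (simp add: lie_torus_def)

lemma br_linear: "Vector_Spaces.linear sc sc (\<lambda>x. br x y)" "Vector_Spaces.linear sc sc (br x)"
  and br_self: "br x x = 0" and jacobi: "br x (br y z) + br y (br z x) + br z (br x y) = 0"
  using torus by (auto simp: lie_torus_def lie_algebra_def)

lemma br_simps [simp]:
  "br (x + x') y = br x y + br x' y" "br x (y + y') = br x y + br x y'"
  "br (sc c x) y = sc c (br x y)" "br x (sc c y) = sc c (br x y)"
  "br 0 y = 0" "br x 0 = 0" "br (- x) y = - br x y" "br x (- y) = - br x y"
  "br (sum g A) y = (\<Sum>a\<in>A. br (g a) y)" "br x (sum g A) = (\<Sum>a\<in>A. br x (g a))"
  by (rule linear_iff_module_hom[THEN iffD1, OF br_linear(1), THEN module_hom.add]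
      linear_iff_module_hom[THEN iffD1, OF br_linear(2), THEN module_hom.add]
      linear_iff_module_hom[THEN iffD1, OF br_linear(1), THEN module_hom.scale]
      linear_iff_module_hom[THEN iffD1, OF br_linear(2), THEN module_hom.scale]
      linear_iff_module_hom[THEN iffD1, OF br_linear(1), THEN module_hom.zero]
      linear_iff_module_hom[THEN iffD1, OF br_linear(2), THEN module_hom.zero]
      linear_iff_module_hom[THEN iffD1, OF br_linear(1), THEN module_hom.neg]
      linear_iff_module_hom[THEN iffD1, OF br_linear(2), THEN module_hom.neg]
      linear_iff_module_hom[THEN iffD1, OF br_linear(1), THEN module_hom.sum]
      linear_iff_module_hom[THEN iffD1, OF br_linear(2), THEN module_hom.sum])+

lemma br_anti: "br x y = - br y x"
proof -
  have "br (x + y) (x + y) = br x x + br y x + (br x y + br y y)" by (simp only: br_simps)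
  then have "0 = br y x + br x y" unfolding br_self add_0_left add_0_right .
  then show ?thesis by (metis add.commute eq_neg_iff_add_eq_0)
qed

lemma br_br_left: "br (br x y) z = br x (br y z) - br y (br x z)"
proof -
  have "br x (br y z) + - br y (br x z) + - br (br x y) z = 0"
    using jacobi[of x y z] unfolding br_anti[of z "br x y"] br_anti[of z x] br_simps .
  then show ?thesis by (simp add: algebra_simps)
qed

section \<open>Homogeneous components of a graded algebra\<close>

lemma subspace_G: "subspace (G \<alpha> l)"
  and G_outside: "\<alpha> \<notin> Q \<or> l \<notin> Zn n \<Longrightarrow> G \<alpha> l = {0}"
  and br_G: "x \<in> G \<alpha> l \<Longrightarrow> y \<in> G \<beta> \<mu> \<Longrightarrow> br x y \<in> G (\<alpha> + \<beta>) (l + \<mu>)"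
  using grading unfolding is_grading_def by blast+

lemma G_zero [simp]: "0 \<in> G \<alpha> l" by (rule subspace_0[OF subspace_G])

lemma G_nontrivial: "G \<alpha> l \<noteq> {0} \<longleftrightarrow> (\<exists>x\<in>G \<alpha> l. x \<noteq> 0)"
  using G_zero by blast

text \<open>The body repeats the decomposition clause of \<open>is_grading\<close> literally, so
  that its unique existence can be obtained by folding.\<close>

definition is_decomp where
  "is_decomp x f \<longleftrightarrow> finite {p. f (fst p) (snd p) \<noteq> 0} \<and> (\<forall>\<alpha> la. f \<alpha> la \<in> G \<alpha> la) \<and>
              x = (\<Sum>p\<in>{p. f (fst p) (snd p) \<noteq> 0}. f (fst p) (snd p))"

definition comp where "comp x p = (THE f. is_decomp x f) (fst p) (snd p)"

lemma ex1_decomp: "\<exists>!f. is_decomp x f"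
  using grading[unfolded is_grading_def, folded is_decomp_def, THEN conjunct2, THEN conjunct2, THEN conjunct1, THEN spec] .

lemma comp_decomp: "is_decomp x (THE f. is_decomp x f)"
  by (rule theI'[OF ex1_decomp])

lemma finite_comp: "finite {p. comp x p \<noteq> 0}"
  and comp_in: "comp x (\<alpha>, l) \<in> G \<alpha> l"
  and sum_comp: "x = (\<Sum>p | comp x p \<noteq> 0. comp x p)"
proof -
  note * = iffD1[OF is_decomp_def comp_decomp, of x]
  show "finite {p. comp x p \<noteq> 0}" using * unfolding comp_def by (elim conjE)
  show "comp x (\<alpha>, l) \<in> G \<alpha> l" using * unfolding comp_def fst_conv snd_conv by (elim conjE allE)
  show "x = (\<Sum>p | comp x p \<noteq> 0. comp x p)" using * unfolding comp_def by (elim conjE)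
qed

lemma sum_comp': "finite P \<Longrightarrow> {p. comp x p \<noteq> 0} \<subseteq> P \<Longrightarrow> x = (\<Sum>p\<in>P. comp x p)"
  by (subst sum_comp) (auto intro: sum.mono_neutral_left)

lemma comp_unique:
  assumes "finite P" "\<And>\<alpha> l. g (\<alpha>, l) \<in> G \<alpha> l" "\<And>p. p \<notin> P \<Longrightarrow> g p = 0" "x = (\<Sum>p\<in>P. g p)"
  shows "comp x p = g p"
proof -
  have sub: "{p. g p \<noteq> 0} \<subseteq> P" using assms(3) by auto
  have "is_decomp x (\<lambda>\<alpha> l. g (\<alpha>, l))"
    unfolding is_decomp_def
  proof (intro conjI allI)
    show "finite {p. g (fst p, snd p) \<noteq> 0}" using finite_subset[OF sub assms(1)] by simp
    show "x = (\<Sum>p | g (fst p, snd p) \<noteq> 0. g (fst p, snd p))"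
      unfolding assms(4) prod.collapse by (rule sum.mono_neutral_right) (use assms(1) sub in auto)
  qed (use assms(2) in auto)
  then have "(THE f. is_decomp x f) = (\<lambda>\<alpha> l. g (\<alpha>, l))" using ex1_decomp by (intro the1_equality)
  then show ?thesis by (simp add: comp_def)
qed

lemma comp_add [simp]: "comp (x + y) p = comp x p + comp y p"
proof (rule comp_unique[where P = "{p. comp x p \<noteq> 0} \<union> {p. comp y p \<noteq> 0}"])
  let ?P = "{p. comp x p \<noteq> 0} \<union> {p. comp y p \<noteq> 0}"
  have "finite ?P" using finite_comp by auto
  then show "x + y = (\<Sum>p\<in>?P. comp x p + comp y p)"
    unfolding sum.distrib by (intro arg_cong2[of _ _ _ _ "(+)"] sum_comp') auto
qed (use finite_comp comp_in subspace_add[OF subspace_G] in auto)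

lemma comp_scale [simp]: "comp (sc c x) p = sc c (comp x p)"
proof (rule comp_unique[where P = "{p. comp x p \<noteq> 0}"])
  show "sc c x = (\<Sum>p | comp x p \<noteq> 0. sc c (comp x p))"
    unfolding scale_sum_right[symmetric] by (rule arg_cong[OF sum_comp])
qed (use finite_comp comp_in subspace_scale[OF subspace_G] in auto)

lemma comp_hom: assumes "x \<in> G \<alpha> l" shows "comp x p = (if p = (\<alpha>, l) then x else 0)"
  by (rule comp_unique[where P = "{(\<alpha>, l)}"]) (use assms in auto)

lemma comp_zero [simp]: "comp 0 p = 0"
  using comp_hom[OF G_zero] by auto

lemma comp_sum: "comp (sum g A) p = (\<Sum>a\<in>A. comp (g a) p)"
  by (induction A rule: infinite_finite_induct) auto

lemma comp_eqI: "(\<And>p. comp x p = comp y p) \<Longrightarrow> x = y"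
  using trans[OF sum_comp[of x] trans[OF _ sum_comp[of y, symmetric]]] by presburger

lemma G_disjoint: "x \<in> G \<alpha> l \<Longrightarrow> x \<in> G \<beta> \<mu> \<Longrightarrow> x \<noteq> 0 \<Longrightarrow> \<alpha> = \<beta> \<and> l = \<mu>"
  using comp_hom[of x \<alpha> l "(\<beta>, \<mu>)"] comp_hom[of x \<beta> \<mu> "(\<beta>, \<mu>)"] by (auto split: if_splits)

lemma comp_br: assumes "d \<in> G \<beta> \<mu>" shows "comp (br d x) (\<beta> + \<alpha>, \<mu> + l) = br d (comp x (\<alpha>, l))"
proof -
  let ?P = "{p. comp x p \<noteq> 0}"
  have "comp (br d x) q = br d (comp x (q - (\<beta>, \<mu>)))" for q
  proof (rule comp_unique[where P = "(\<lambda>p. (\<beta>, \<mu>) + p) ` ?P"])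
    fix \<gamma> \<nu> show "br d (comp x ((\<gamma>, \<nu>) - (\<beta>, \<mu>))) \<in> G \<gamma> \<nu>"
      using br_G[OF assms comp_in[of x "\<gamma> - \<beta>" "\<nu> - \<mu>"]] by simp
  next
    have "br d x = (\<Sum>p\<in>?P. br d (comp x p))" by (subst sum_comp[of x]) simp
    also have "\<dots> = (\<Sum>q\<in>(\<lambda>p. (\<beta>, \<mu>) + p) ` ?P. br d (comp x (q - (\<beta>, \<mu>))))"
      by (subst sum.reindex) (auto simp: inj_on_def o_def add_diff_cancel_left')
    finally show "br d x = (\<Sum>q\<in>(\<lambda>p. (\<beta>, \<mu>) + p) ` ?P. br d (comp x (q - (\<beta>, \<mu>))))" .
  next
    fix q assume q: "q \<notin> (\<lambda>p. (\<beta>, \<mu>) + p) ` ?P"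
    have "comp x (q - (\<beta>, \<mu>)) = 0"
    proof (rule ccontr)
      assume "comp x (q - (\<beta>, \<mu>)) \<noteq> 0"
      then have "(\<beta>, \<mu>) + (q - (\<beta>, \<mu>)) \<in> (\<lambda>p. (\<beta>, \<mu>) + p) ` ?P" by blast
      then show False using q by simp
    qed
    then show "br d (comp x (q - (\<beta>, \<mu>))) = 0" by simp
  qed (use finite_comp in auto)
  from this[of "(\<beta> + \<alpha>, \<mu> + l)"] show ?thesis by (simp only: diff_Pair add_diff_cancel_left')
qed

abbreviation "L \<alpha> \<equiv> gcomp_root sc G \<alpha>"

lemma L_iff: "x \<in> L \<alpha> \<longleftrightarrow> (\<forall>\<beta> l. \<beta> \<noteq> \<alpha> \<longrightarrow> comp x (\<beta>, l) = 0)"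
proof
  assume "x \<in> L \<alpha>"
  then show "\<forall>\<beta> l. \<beta> \<noteq> \<alpha> \<longrightarrow> comp x (\<beta>, l) = 0"
    unfolding gcomp_root_def
    by (induction rule: span_induct_alt) (auto simp: comp_hom)
next
  assume *: "\<forall>\<beta> l. \<beta> \<noteq> \<alpha> \<longrightarrow> comp x (\<beta>, l) = 0"
  have "comp x p \<in> L \<alpha>" for p
  proof (cases p)
    case (Pair \<beta> l)
    show ?thesis
    proof (cases "\<beta> = \<alpha>")
      case True then show ?thesis using Pair comp_in[of x \<alpha> l] by (auto simp: gcomp_root_def intro: span_base)
    next
      case False then show ?thesis using * Pair span_zero by (auto simp: gcomp_root_def)
    qed
  qed
  then have "(\<Sum>p | comp x p \<noteq> 0. comp x p) \<in> L \<alpha>"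
    unfolding gcomp_root_def by (intro span_sum)
  then show "x \<in> L \<alpha>" by (simp only: sum_comp[symmetric])
qed

lemma G_subset_L: "x \<in> G \<alpha> l \<Longrightarrow> x \<in> L \<alpha>"
  by (auto simp: gcomp_root_def intro: span_base)

section \<open>The Lie torus axioms and the degree-zero root space\<close>

lemma LT1: "\<alpha> \<in> D \<longleftrightarrow> (\<exists>l. G \<alpha> l \<noteq> {0})"
  and LT2i: "\<alpha> \<in> J \<Longrightarrow> G \<alpha> 0 \<noteq> {0}"
  and LT3: "lie_gen sc br (\<Union>\<alpha>\<in>R. L \<alpha>) = UNIV"
  and LT4: "subgroup_gen {l. \<exists>\<alpha>. G \<alpha> l \<noteq> {0}} = Zn n"
proof -
  have "{\<alpha>. \<exists>la. G \<alpha> la \<noteq> {0}} = D" using torus unfolding lie_torus_def by (elim conjE)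
  then show "\<alpha> \<in> D \<longleftrightarrow> (\<exists>l. G \<alpha> l \<noteq> {0})" by blast
  have "\<forall>\<alpha>\<in>J. G \<alpha> 0 \<noteq> {0}" using torus unfolding lie_torus_def by (elim conjE)
  then show "\<alpha> \<in> J \<Longrightarrow> G \<alpha> 0 \<noteq> {0}" by blast
  show "lie_gen sc br (\<Union>\<alpha>\<in>R. L \<alpha>) = UNIV" using torus unfolding lie_torus_def by (elim conjE)
  show "subgroup_gen {l. \<exists>\<alpha>. G \<alpha> l \<noteq> {0}} = Zn n" using torus unfolding lie_torus_def by (elim conjE)
qed

lemma D_subset_Q: "\<alpha> \<in> D \<Longrightarrow> \<alpha> \<in> Q" by (rule subgroup_gen_base)

lemma G_not_D: "\<alpha> \<notin> D \<Longrightarrow> G \<alpha> l = {0}" using LT1 by blast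

lemma sl2_triple:
  assumes "\<alpha> \<in> R" "G \<alpha> l \<noteq> {0}"
  obtains e f where "e \<in> G \<alpha> l" "f \<in> G (- \<alpha>) (- l)" "G \<alpha> l = range (\<lambda>c. sc c e)"
    "G (- \<alpha>) (- l) = range (\<lambda>c. sc c f)"
    "\<And>\<beta> \<mu> m x. real_of_int m = cartan \<beta> \<alpha> \<Longrightarrow> x \<in> G \<beta> \<mu> \<Longrightarrow> br (br e f) x = sc (of_int m) x"
proof -
  have "\<forall>\<alpha>\<in>R. \<forall>la. G \<alpha> la \<noteq> {0} \<longrightarrow>
        (\<exists>e f. e \<in> G \<alpha> la \<and> f \<in> G (- \<alpha>) (- la) \<and>
           G \<alpha> la = {sc c e | c. True} \<and> G (- \<alpha>) (- la) = {sc c f | c. True} \<and>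
           (\<forall>\<beta>\<in>Q. \<forall>m::int. real_of_int m = cartan \<beta> \<alpha> \<longrightarrow> (\<forall>x\<in>L \<beta>. br (br e f) x = sc (of_int m) x)))"
    using torus unfolding lie_torus_def by (elim conjE)
  from this[rule_format, OF assms] obtain e f where *: "e \<in> G \<alpha> l" "f \<in> G (- \<alpha>) (- l)"
    "G \<alpha> l = {sc c e | c. True}" "G (- \<alpha>) (- l) = {sc c f | c. True}"
    and act: "\<And>\<beta> m x. \<beta> \<in> Q \<Longrightarrow> real_of_int m = cartan \<beta> \<alpha> \<Longrightarrow> x \<in> L \<beta> \<Longrightarrow> br (br e f) x = sc (of_int m) x"
    by (elim exE conjE) blast
  have "br (br e f) x = sc (of_int m) x" if "real_of_int m = cartan \<beta> \<alpha>" "x \<in> G \<beta> \<mu>" for \<beta> \<mu> m x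
  proof (cases "\<beta> \<in> Q")
    case False then show ?thesis using that G_outside[of \<beta> \<mu>] by auto
  qed (use act that G_subset_L in blast)
  then show thesis using that[of e f] * by (simp only: full_SetCompr_eq) blast
qed

lemma br_in_span:
  assumes A: "\<And>x y. x \<in> A \<Longrightarrow> y \<in> A \<Longrightarrow> br x y \<in> span A" and "x \<in> span A" "y \<in> span A"
  shows "br x y \<in> span A"
proof -
  have 1: "br x y \<in> span A" if "x \<in> A" "y \<in> span A" for x y
    using that(2) by (induction rule: span_induct_alt) (auto intro: span_zero span_add span_scale A that)
  show ?thesis using assms(2) by (induction rule: span_induct_alt) (auto intro: span_zero span_add span_scale 1 assms(3))
qed

text \<open>By the Jacobi identity, the sum of the root spaces and of the brackets of opposite root spaces is a
  subalgebra, hence everything.\<close>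
lemma zero_space_span:
  "G 0 \<nu> \<subseteq> span {br x y | \<alpha> \<mu> x y. \<alpha> \<in> R \<and> x \<in> G \<alpha> \<mu> \<and> y \<in> G (- \<alpha>) (\<nu> - \<mu>)}"
proof -
  define N where "N = (\<Union>\<alpha>\<in>R. \<Union>l. G \<alpha> l)"
  define B where "B = {br x y | \<alpha> \<mu> \<nu> x y. \<alpha> \<in> R \<and> x \<in> G \<alpha> \<mu> \<and> y \<in> G (- \<alpha>) \<nu>}"
  have B: "\<exists>l. d \<in> G 0 l" if d: "d \<in> B" for d
  proof -
    obtain \<alpha> \<mu> \<nu> x y where "d = br x y" "x \<in> G \<alpha> \<mu>" "y \<in> G (- \<alpha>) \<nu>" using d by (auto simp: B_def)
    then show ?thesis using br_G[of x \<alpha> \<mu> y "- \<alpha>" \<nu>] by auto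
  qed
  have N: "\<exists>\<alpha> l. \<alpha> \<in> R \<and> x \<in> G \<alpha> l" if "x \<in> N" for x using that by (auto simp: N_def)
  have BN: "br d x \<in> N" if d: "d \<in> B" and x: "x \<in> N" for d x
  proof -
    obtain l where "d \<in> G 0 l" using B[OF d] by auto
    moreover obtain \<alpha> l' where "\<alpha> \<in> R" "x \<in> G \<alpha> l'" using N[OF x] by auto
    ultimately show ?thesis using br_G[of d 0 l x \<alpha> l'] by (auto simp: N_def)
  qed
  have neg: "- x \<in> span A" if "x \<in> A" for x A using that by (intro span_neg span_base)
  have "br x y \<in> span (N \<union> B)" if x: "x \<in> N \<union> B" and y: "y \<in> N \<union> B" for x y
  proof (cases "x \<in> N")
    case xN: True
    show ?thesis
    proof (cases "y \<in> N")
      case True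
      obtain \<alpha> l \<beta> \<mu> where ab: "\<alpha> \<in> R" "x \<in> G \<alpha> l" "\<beta> \<in> R" "y \<in> G \<beta> \<mu>" using N[OF xN] N[OF True] by blast
      show ?thesis
      proof (cases "\<alpha> + \<beta> = 0")
        case True
        then have "\<beta> = - \<alpha>" by (rule eq_neg_iff_add_eq_0[THEN iffD2, OF trans[OF add.commute]])
        then have "br x y \<in> B" using ab unfolding B_def by blast
        then show ?thesis by (intro span_base) auto
      next
        case False
        show ?thesis
        proof (cases "br x y = 0")
          case True then show ?thesis using span_zero by simp
        next
          case nz: False
          then have "\<alpha> + \<beta> \<in> D" using br_G[OF ab(2,4)] LT1 by blast
          then have "br x y \<in> N" using br_G[OF ab(2,4)] False unfolding N_def by blast
          then show ?thesis by (intro span_base) auto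
        qed
      qed
    next
      case False
      then have "br y x \<in> N" using BN y xN by auto
      then show ?thesis using neg[of "br y x" "N \<union> B"] br_anti[of x y] by auto
    qed
  next
    case False
    then have xB: "x \<in> B" using x by auto
    show ?thesis
    proof (cases "y \<in> N")
      case True then show ?thesis using BN[OF xB] by (intro span_base) auto
    next
      case False
      then have "y \<in> B" using y by auto
      then obtain \<alpha> \<mu> \<nu> a b where ab: "\<alpha> \<in> R" "y = br a b" "a \<in> G \<alpha> \<mu>" "b \<in> G (- \<alpha>) \<nu>"
        unfolding B_def by blast
      obtain l where l: "x \<in> G 0 l" using B[OF xB] by auto
      \<comment> \<open>Bracketing with x is a derivation and, since x has root 0, keeps a and b in
        their root spaces; both summands are again brackets of opposite root vectors.\<close>
      have "br x y = br (br x a) b + br a (br x b)" unfolding ab(2) br_br_left by simp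
      moreover have "br x a \<in> G \<alpha> (l + \<mu>)" "br x b \<in> G (- \<alpha>) (l + \<nu>)"
        using br_G[OF l ab(3)] br_G[OF l ab(4)] by simp_all
      then have "br (br x a) b \<in> B" "br a (br x b) \<in> B" using ab unfolding B_def by blast+
      ultimately show ?thesis by (auto intro!: span_add intro: span_base)
    qed
  qed
  then have closed: "br x y \<in> span (N \<union> B)" if "x \<in> span (N \<union> B)" "y \<in> span (N \<union> B)" for x y
    using br_in_span that by blast
  have "L \<alpha> \<subseteq> span (N \<union> B)" if "\<alpha> \<in> R" for \<alpha>
    unfolding gcomp_root_def using that by (intro span_mono) (auto simp: N_def)
  then have UNIV: "span (N \<union> B) = UNIV"
    using LT3 closed unfolding lie_gen_def by (blast intro: subspace_span)
  let ?Z = "{br x y | \<alpha> \<mu> x y. \<alpha> \<in> R \<and> x \<in> G \<alpha> \<mu> \<and> y \<in> G (- \<alpha>) (\<nu> - \<mu>)}"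
  \<comment> \<open>Projection onto degree (0, \<nu>) sends a generator either to 0 or, for a
    bracket of total degree \<nu>, to itself; this isolates the generators of
    \<open>G 0 \<nu>\<close>.\<close>
  have gen: "comp z (0, \<nu>) \<in> span ?Z" if zNB: "z \<in> N \<union> B" for z
  proof (cases "z \<in> N")
    case True
    then obtain \<alpha> l where "\<alpha> \<in> R" "z \<in> G \<alpha> l" using N by blast
    then show ?thesis using comp_hom[of z \<alpha> l] span_zero by auto
  next
    case False
    then obtain \<alpha> \<mu> \<mu>' x y where z: "z = br x y" "\<alpha> \<in> R" "x \<in> G \<alpha> \<mu>" "y \<in> G (- \<alpha>) \<mu>'"
      using zNB unfolding B_def by blast
    have zG: "z \<in> G 0 (\<mu> + \<mu>')" using br_G[OF z(3,4)] z(1) by simp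
    show ?thesis
    proof (cases "\<mu> + \<mu>' = \<nu>")
      case True
      then have "\<mu>' = \<nu> - \<mu>" by (metis add_diff_cancel_left')
      then have "z \<in> ?Z" using z by blast
      moreover have "comp z (0, \<nu>) = z" using comp_hom[OF zG] True by simp
      ultimately show ?thesis using span_base[of z ?Z] by simp
    next
      case False
      then show ?thesis using comp_hom[OF zG] span_zero by auto
    qed
  qed
  have "span (N \<union> B) \<subseteq> {z. comp z (0, \<nu>) \<in> span ?Z}"
  proof (rule span_minimal)
    show "subspace {z. comp z (0, \<nu>) \<in> span ?Z}"
      by (simp add: subspace_def span_zero span_add span_scale)
  qed (use gen in blast)
  then have all: "comp z (0, \<nu>) \<in> span ?Z" if "z \<in> span (N \<union> B)" for z using that by blast
  show ?thesis
  proof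
    fix z assume "z \<in> G 0 \<nu>"
    then have "comp z (0, \<nu>) = z" using comp_hom[of z 0 \<nu> "(0, \<nu>)"] by simp
    then show "z \<in> span ?Z" using all[of z] UNIV by simp
  qed
qed

lemma zero_space_bracket:
  assumes "G 0 \<nu> \<noteq> {0}" shows "\<exists>\<alpha> \<mu>. \<alpha> \<in> R \<and> G \<alpha> \<mu> \<noteq> {0} \<and> G (- \<alpha>) (\<nu> - \<mu>) \<noteq> {0}"
proof (rule ccontr)
  assume none: "\<not> ?thesis"
  have "{br x y | \<alpha> \<mu> x y. \<alpha> \<in> R \<and> x \<in> G \<alpha> \<mu> \<and> y \<in> G (- \<alpha>) (\<nu> - \<mu>)} \<subseteq> {0}"
  proof (intro subsetI)
    fix z assume "z \<in> {br x y | \<alpha> \<mu> x y. \<alpha> \<in> R \<and> x \<in> G \<alpha> \<mu> \<and> y \<in> G (- \<alpha>) (\<nu> - \<mu>)}"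
    then obtain \<alpha> \<mu> x y where z: "z = br x y" "\<alpha> \<in> R" "x \<in> G \<alpha> \<mu>" "y \<in> G (- \<alpha>) (\<nu> - \<mu>)" by blast
    then have "x = 0 \<or> y = 0" using none by blast
    then show "z \<in> {0}" using z(1) by auto
  qed
  from span_mono[OF this] zero_space_span[of \<nu>] have "G 0 \<nu> \<subseteq> {0}" by (auto simp: span_singleton)
  then show False using assms G_zero by blast
qed

text \<open>A degree occurring at root 0 is the sum of two degrees occurring at opposite nonzero
  roots. (LT4) can therefore be used with nonzero roots only, which are the ones on which degrees
  can be compared.\<close>

lemma Zn_generated: "subgroup_gen {l. \<exists>\<alpha>\<in>R. G \<alpha> l \<noteq> {0}} = Zn n"
proof -
  have "l \<in> subgroup_gen {l. \<exists>\<alpha>\<in>R. G \<alpha> l \<noteq> {0}}" if nz: "G \<alpha> l \<noteq> {0}" for \<alpha> l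
  proof (cases "\<alpha> = 0")
    case False
    then show ?thesis using nz LT1 by (intro subgroup_gen_base) auto
  next
    case True
    obtain \<beta> \<mu> where b: "\<beta> \<in> R" "G \<beta> \<mu> \<noteq> {0}" "G (- \<beta>) (l - \<mu>) \<noteq> {0}"
      using zero_space_bracket[of l] nz True by blast
    have "\<mu> + (l - \<mu>) \<in> subgroup_gen {l. \<exists>\<alpha>\<in>R. G \<alpha> l \<noteq> {0}}"
      by (intro subgroup_gen_add subgroup_gen_base) (use b minus_R in blast)+
    then show ?thesis by simp
  qed
  then show ?thesis unfolding LT4[symmetric]
    by (intro equalityI subgroup_gen_mono) (blast intro: subgroup_gen_base)+
qed

text \<open>Additivity on the whole root lattice is built in: it fixes w at lattice points whose
  components vanish, where the eigenvalue equation says nothing, and it lets a correspondence of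
  roots extend to the lattices.\<close>

definition "weight d w \<longleftrightarrow> (\<forall>x\<in>Q. \<forall>y\<in>Q. w (x + y) = w x + w y) \<and> (\<forall>\<beta>\<in>Q. \<forall>\<mu>. \<forall>x\<in>G \<beta> \<mu>. br d x = sc (w \<beta>) x)"

definition pairing :: "rvec \<Rightarrow> rvec \<Rightarrow> int" where "pairing \<beta> \<alpha> = \<lfloor>cartan \<beta> \<alpha>\<rfloor>"

lemma pairing: "\<beta> \<in> Q \<Longrightarrow> \<alpha> \<in> R \<Longrightarrow> real_of_int (pairing \<beta> \<alpha>) = cartan \<beta> \<alpha>"
  using cartan_Q_int by (simp add: pairing_def)

lemma pairing_add: assumes "x \<in> Q" "y \<in> Q" "\<alpha> \<in> R" shows "pairing (x + y) \<alpha> = pairing x \<alpha> + pairing y \<alpha>"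
proof -
  have "real_of_int (pairing (x + y) \<alpha>) = real_of_int (pairing x \<alpha> + pairing y \<alpha>)"
    using pairing assms subgroup_gen_add[OF assms(1,2)] cartan_left(1)[of x y \<alpha>] by simp
  then show ?thesis by (simp only: of_int_eq_iff)
qed

lemma weight_coroot:
  assumes "\<alpha> \<in> R" obtains d where "d \<in> G 0 0" "weight d (\<lambda>\<beta>. of_int (pairing \<beta> \<alpha>))"
proof -
  obtain l where "G \<alpha> l \<noteq> {0}" using assms LT1 by blast
  from sl2_triple[OF assms this] obtain e f where ef: "e \<in> G \<alpha> l" "f \<in> G (- \<alpha>) (- l)"
    "\<And>\<beta> \<mu> m x. real_of_int m = cartan \<beta> \<alpha> \<Longrightarrow> x \<in> G \<beta> \<mu> \<Longrightarrow> br (br e f) x = sc (of_int m) x" by metis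
  have "weight (br e f) (\<lambda>\<beta>. of_int (pairing \<beta> \<alpha>))"
    unfolding weight_def using ef(3)[OF pairing[OF _ assms]] pairing_add[OF _ _ assms] by auto
  then show thesis using that br_G[OF ef(1,2)] by simp
qed

text \<open>The component of degree (0, 0) is spanned by brackets of opposite root vectors, and each
  of these is a multiple of a coroot element, whose eigenvalues are Cartan integers.\<close>

lemma weight_exists: assumes "d \<in> G 0 0" obtains w where "weight d w"
proof -
  have 0: "weight 0 (\<lambda>_. 0)" by (simp add: weight_def)
  have gen: "\<exists>w. weight (br x y) w" if xy: "\<alpha> \<in> R" "x \<in> G \<alpha> \<mu>" "y \<in> G (- \<alpha>) (0 - \<mu>)" for \<alpha> \<mu> x y
  proof (cases "G \<alpha> \<mu> = {0}")
    case True then show ?thesis using xy 0 by auto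
  next
    case False
    from sl2_triple[OF xy(1) this] obtain e f where ef: "e \<in> G \<alpha> \<mu>" "f \<in> G (- \<alpha>) (- \<mu>)"
      "G \<alpha> \<mu> = range (\<lambda>c. sc c e)" "G (- \<alpha>) (- \<mu>) = range (\<lambda>c. sc c f)"
      "\<And>\<beta> \<mu> m x. real_of_int m = cartan \<beta> \<alpha> \<Longrightarrow> x \<in> G \<beta> \<mu> \<Longrightarrow> br (br e f) x = sc (of_int m) x" by metis
    obtain c c' where c: "x = sc c e" "y = sc c' f"
      using xy(2,3) unfolding diff_0 ef(3,4) by blast
    have "weight (br x y) (\<lambda>\<beta>. c * c' * of_int (pairing \<beta> \<alpha>))"
      unfolding weight_def c using ef(5)[OF pairing[OF _ xy(1)]] pairing_add[OF _ _ xy(1)] by (auto simp: algebra_simps)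
    then show ?thesis by blast
  qed
  have "d \<in> span {br x y | \<alpha> \<mu> x y. \<alpha> \<in> R \<and> x \<in> G \<alpha> \<mu> \<and> y \<in> G (- \<alpha>) (0 - \<mu>)}"
    using zero_space_span assms by blast
  then have "\<exists>w. weight d w"
  proof (induction rule: span_induct_alt)
    case base then show ?case using 0 by blast
  next
    case (step c x y)
    obtain w where w: "weight x w" using step(1) gen by blast
    obtain w' where w': "weight y w'" using step by blast
    have "weight (sc c x + y) (\<lambda>\<beta>. c * w \<beta> + w' \<beta>)"
      using w w' by (auto simp: weight_def algebra_simps)
    then show ?case by blast
  qed
  then show thesis using that by blast
qed

end

section \<open>Homogeneity of invertible elements\<close>

text \<open>Lexicographic comparison at the first index of difference. Such an index exists for any
  two distinct functions on the naturals, so the order is total, and it is invariant under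
  translation.\<close>

definition lex_less :: "(nat \<Rightarrow> int) \<Rightarrow> (nat \<Rightarrow> int) \<Rightarrow> bool" where
  "lex_less l m \<longleftrightarrow> (\<exists>k. l k < m k \<and> (\<forall>j<k. l j = m j))"

lemma transp_lex_less: "transp lex_less"
proof (rule transpI)
  fix a b c assume "lex_less a b" "lex_less b c"
  then obtain i j where ij: "a i < b i" "\<forall>k<i. a k = b k" "b j < c j" "\<forall>k<j. b k = c k"
    unfolding lex_less_def by blast
  have "a (min i j) < c (min i j)" using ij by (cases i j rule: linorder_cases; simp add: min_def)
  moreover have "a k = c k" if "k < min i j" for k using that ij by simp
  ultimately show "lex_less a c" unfolding lex_less_def by blast
qed

lemma asymp_lex_less: "asymp lex_less"
proof (rule asympI)
  fix a b assume "lex_less a b"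
  then obtain i where i: "a i < b i" "\<forall>k<i. a k = b k" unfolding lex_less_def by blast
  show "\<not> lex_less b a"
  proof
    assume "lex_less b a"
    then obtain j where "b j < a j" "\<forall>k<j. b k = a k" unfolding lex_less_def by blast
    then show False using i by (metis less_asym less_irrefl linorder_neqE_nat)
  qed
qed

lemma totalp_lex_less: "totalp lex_less"
proof (rule totalpI)
  fix a b :: "nat \<Rightarrow> int" assume "a \<noteq> b"
  then have ex: "\<exists>k. a k \<noteq> b k" by auto
  define k where "k = (LEAST k. a k \<noteq> b k)"
  have "a k \<noteq> b k" "\<forall>j<k. a j = b j"
    using LeastI_ex[OF ex] not_less_Least[of _ "\<lambda>k. a k \<noteq> b k"] unfolding k_def by blast+
  then show "lex_less a b \<or> lex_less b a" unfolding lex_less_def by (metis linorder_neqE_linordered_idom)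
qed

lemma lex_less_add: "lex_less a b \<Longrightarrow> lex_less (a + c) (b + c)"
  unfolding lex_less_def by fastforce

context lie_torus_on
begin

section \<open>Triples for sl(2), root strings and leading terms\<close>

definition "triple \<alpha> l e f \<longleftrightarrow> e \<in> G \<alpha> l \<and> f \<in> G (- \<alpha>) (- l) \<and>
  (\<forall>\<beta> \<mu> m x. real_of_int m = cartan \<beta> \<alpha> \<longrightarrow> x \<in> G \<beta> \<mu> \<longrightarrow> br (br e f) x = sc (of_int m) x)"

lemma triple_exists:
  assumes "\<alpha> \<in> R" "G \<alpha> l \<noteq> {0}"
  obtains e f where "triple \<alpha> l e f" "e \<noteq> 0" "G \<alpha> l = range (\<lambda>c. sc c e)"
proof -
  from sl2_triple[OF assms] obtain e f where ef: "e \<in> G \<alpha> l" "f \<in> G (- \<alpha>) (- l)" "G \<alpha> l = range (\<lambda>c. sc c e)"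
    "\<And>\<beta> \<mu> m x. real_of_int m = cartan \<beta> \<alpha> \<Longrightarrow> x \<in> G \<beta> \<mu> \<Longrightarrow> br (br e f) x = sc (of_int m) x" by metis
  have "e \<noteq> 0" using ef(3) assms(2) by auto
  then show thesis using that[of e f] ef unfolding triple_def by blast
qed

lemma triple_swap: assumes "triple \<alpha> l e f" "\<alpha> \<in> V" shows "triple (- \<alpha>) (- l) f e"
  unfolding triple_def minus_minus
proof (intro conjI allI impI)
  fix \<beta> \<mu> m x assume "real_of_int m = cartan \<beta> (- \<alpha>)" and x: "x \<in> G \<beta> \<mu>"
  then have m: "real_of_int (- m) = cartan \<beta> \<alpha>" using cartan_minus[OF assms(2), of \<beta>] by simp
  have "br (br e f) x = sc (of_int (- m)) x" using assms(1) m x unfolding triple_def by blast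
  then show "br (br f e) x = sc (of_int m) x" unfolding br_anti[of f e] by simp
qed (use assms in \<open>auto simp: triple_def\<close>)

lemma triple_nonzero: assumes "triple \<alpha> l e f" "e \<noteq> 0" "\<alpha> \<in> R" shows "br e f \<noteq> 0" "f \<noteq> 0"
proof -
  have "real_of_int 2 = cartan \<alpha> \<alpha>" using cartan_self[OF assms(3)] by simp
  then have "br (br e f) e = sc (of_int 2) e" using assms(1) unfolding triple_def by blast
  then show "br e f \<noteq> 0" using assms(2) by auto
  then show "f \<noteq> 0" by auto
qed

lemma power_br_G:
  assumes "f \<in> G \<gamma> \<nu>" "v \<in> G \<beta> \<mu>"
  shows "(br f ^^ k) v \<in> G (\<beta> + of_int (int k) * \<gamma>) (\<mu> + of_int (int k) * \<nu>)"
proof (induction k)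
  case 0 then show ?case using assms(2) by simp
next
  case (Suc k)
  have eq: "\<gamma> + (\<beta> + of_int (int k) * \<gamma>) = \<beta> + of_int (int (Suc k)) * \<gamma>"
    and eq': "\<nu> + (\<mu> + of_int (int k) * \<nu>) = \<mu> + of_int (int (Suc k)) * \<nu>"
    by (auto simp: fun_eq_iff algebra_simps)
  show ?case using br_G[OF assms(1) Suc] unfolding eq eq' funpow.simps comp_apply .
qed

text \<open>The string through degree (\<beta>, \<mu>) in direction (\<alpha>, l) is a
  representation of the triple whose weight at position i is k + 2 i. It stops at some B because
  only finitely many \<beta> + i \<alpha> are roots.\<close>

lemma string_nonzero:
  assumes t: "triple \<alpha> l e f" and \<alpha>: "\<alpha> \<in> R" and v: "v \<in> G \<beta> \<mu>" "v \<noteq> 0" and k: "cartan \<beta> \<alpha> = int k"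
  shows "(br f ^^ k) v \<noteq> 0"
proof -
  have \<beta>: "\<beta> \<in> D" using v LT1 by blast
  define W where "W i = G (\<beta> + of_int i * \<alpha>) (\<mu> + of_int i * l)" for i :: int
  have W0: "W 0 = G \<beta> \<mu>" by (simp add: W_def)
  have ef: "e \<in> G \<alpha> l" "f \<in> G (- \<alpha>) (- l)" using t by (auto simp: triple_def)
  have inj: "inj (\<lambda>i::int. \<beta> + of_int i * \<alpha>)"
  proof (rule injI)
    fix i j :: int assume eq: "\<beta> + of_int i * \<alpha> = \<beta> + of_int j * \<alpha>"
    obtain q where "\<alpha> q \<noteq> 0" using \<alpha> by (auto simp: fun_eq_iff)
    then show "i = j" using fun_cong[OF eq, of q] by simp
  qed
  have "finite ((\<lambda>i::int. \<beta> + of_int i * \<alpha>) -` D)" by (rule finite_vimageI[OF finite_D inj])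
  then obtain B where B: "\<forall>i\<in>(\<lambda>i::int. \<beta> + of_int i * \<alpha>) -` D. i < B"
    using finite_nat_set_iff_bounded by (metis bdd_above_finite bdd_above.unfold le_less_trans less_add_one)
  show ?thesis
  proof (rule sl2_string_nonzero[where E = "br e" and F = "br f" and V = W and B = B and i = 0 and m = "int k",
        OF vector_space_axioms br_linear(2) br_linear(2)])
    fix i x assume x: "x \<in> W i"
    have eq: "\<alpha> + (\<beta> + of_int i * \<alpha>) = \<beta> + of_int (i + 1) * \<alpha>" "l + (\<mu> + of_int i * l) = \<mu> + of_int (i + 1) * l"
      "- \<alpha> + (\<beta> + of_int i * \<alpha>) = \<beta> + of_int (i - 1) * \<alpha>" "- l + (\<mu> + of_int i * l) = \<mu> + of_int (i - 1) * l"
      by (auto simp: fun_eq_iff algebra_simps)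
    show "br e x \<in> W (i + 1)" "br f x \<in> W (i - 1)"
      using br_G[OF ef(1) x[unfolded W_def]] br_G[OF ef(2) x[unfolded W_def]] unfolding W_def eq .
    have "cartan (\<beta> + rscale (of_int i) \<alpha>) \<alpha> = cartan \<beta> \<alpha> + of_int i * 2"
      using \<alpha> \<beta> cartan_self[OF \<alpha>] by (simp add: cartan_left)
    then have "real_of_int (int k + 2 * i) = cartan (\<beta> + of_int i * \<alpha>) \<alpha>" using k by (simp add: rscale_of_int)
    then have "br (br e f) x = sc (of_int (int k + 2 * i)) x" using t x unfolding triple_def W_def by blast
    then show "br e (br f x) = br f (br e x) + sc (of_int (int k + 2 * i)) x" unfolding br_br_left
      by (simp add: algebra_simps)
    assume "i \<ge> B"
    have "\<beta> + of_int i * \<alpha> \<notin> D"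
    proof
      assume "\<beta> + of_int i * \<alpha> \<in> D"
      then have "i \<in> (\<lambda>i::int. \<beta> + of_int i * \<alpha>) -` D" by (rule vimageI2)
      then show False using B \<open>i \<ge> B\<close> leD by blast
    qed
    then show "x = 0" using x G_not_D unfolding W_def by blast
  qed (use v W0 in auto)
qed

text \<open>For the swapped triple y has weight 2, so even the second power of the bracket with e
  does not kill it; x is a nonzero multiple of e because the space is a line.\<close>

lemma br_opposite_nonzero:
  assumes \<alpha>: "\<alpha> \<in> R" and x: "x \<in> G \<alpha> l" "x \<noteq> 0" and y: "y \<in> G (- \<alpha>) \<nu>" "y \<noteq> 0"
  shows "br x y \<noteq> 0"
proof -
  have "G \<alpha> l \<noteq> {0}" using x by blast
  from triple_exists[OF \<alpha> this] obtain e f where t: "triple \<alpha> l e f" and G: "G \<alpha> l = range (\<lambda>c. sc c e)" by metis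
  obtain c where c: "x = sc c e" using x(1) G by auto
  have "cartan (- \<alpha>) (- \<alpha>) = int 2" using cartan_self[OF minus_R[OF \<alpha>]] by simp
  from string_nonzero[OF triple_swap[OF t] minus_R[OF \<alpha>] y this] \<alpha> have "(br e ^^ 2) y \<noteq> 0" by simp
  then have "br e y \<noteq> 0" by (auto simp: numeral_2_eq_2)
  then show ?thesis using c x(2) by auto
qed

text \<open>The leading terms of x and y have a nonzero bracket, which is the component of
  \<open>br x y\<close> in degree a + b; as the bracket is concentrated in degree 0, this sum is 0.
  The order is a parameter so that the converse order yields the lowest terms.\<close>

lemma leading_degrees:
  assumes lt: "transp lt" "asymp lt" "totalp lt" "\<And>a b c. lt a b \<Longrightarrow> lt (a + c) (b + c)"
    and \<alpha>: "\<alpha> \<in> R" and x: "x \<in> L \<alpha>" and y: "y \<in> L (- \<alpha>)" and d: "br x y \<in> G 0 0" "br x y \<noteq> 0"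
  shows "\<exists>a b. a + b = 0 \<and> comp x (\<alpha>, a) \<noteq> 0 \<and> comp y (- \<alpha>, b) \<noteq> 0 \<and>
     (\<forall>c. comp x (\<alpha>, c) \<noteq> 0 \<longrightarrow> c = a \<or> lt c a) \<and> (\<forall>c. comp y (- \<alpha>, c) \<noteq> 0 \<longrightarrow> c = b \<or> lt c b)"
proof -
  have greatest: "\<exists>a. comp z (\<beta>, a) \<noteq> 0 \<and> (\<forall>c. comp z (\<beta>, c) \<noteq> 0 \<longrightarrow> c = a \<or> lt c a)"
    if z: "z \<in> L \<beta>" "z \<noteq> 0" for z \<beta>
  proof -
    define A where "A = {a. comp z (\<beta>, a) \<noteq> 0}"
    have "Pair \<beta> ` A \<subseteq> {p. comp z p \<noteq> 0}" by (auto simp: A_def)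
    then have "finite (Pair \<beta> ` A)" by (rule finite_subset[OF _ finite_comp])
    then have "finite A" by (rule finite_imageD) (auto simp: inj_on_def)
    moreover have "A \<noteq> {}"
    proof
      assume e: "A = {}"
      have "comp z p = comp 0 p" for p
      proof (cases p)
        case (Pair \<gamma> c)
        have "comp z (\<beta>, c) = 0" using e unfolding A_def by blast
        then show ?thesis using z(1) Pair unfolding L_iff by (cases "\<gamma> = \<beta>") simp_all
      qed
      then show False using comp_eqI z(2) by blast
    qed
    moreover have "asymp_on A lt" "transp_on A lt"
      using lt(1,2) by (auto intro: asymp_on_subset transp_on_subset)
    ultimately obtain a where a: "a \<in> A" "\<forall>c\<in>A. c \<noteq> a \<longrightarrow> \<not> lt a c"
      using Finite_Set.bex_max_element[of A lt] by blast
    have "c = a \<or> lt c a" if "comp z (\<beta>, c) \<noteq> 0" for c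
      using a(2) that totalpD[OF lt(3), of a c] unfolding A_def by blast
    then show ?thesis using a(1) unfolding A_def by blast
  qed
  have xy: "x \<noteq> 0" "y \<noteq> 0" using d by auto
  obtain a where a: "comp x (\<alpha>, a) \<noteq> 0" "\<forall>c. comp x (\<alpha>, c) \<noteq> 0 \<longrightarrow> c = a \<or> lt c a"
    using greatest[OF x xy(1)] by blast
  obtain b where b: "comp y (- \<alpha>, b) \<noteq> 0" "\<forall>c. comp y (- \<alpha>, c) \<noteq> 0 \<longrightarrow> c = b \<or> lt c b"
    using greatest[OF y xy(2)] by blast
  let ?P = "{p. comp x p \<noteq> 0}"
  \<comment> \<open>A component of x in degree c below a contributes to degree a + b only through a
    component of y in degree a + b - c, which lies above the greatest degree b.\<close>
  have other: "comp (br (comp x p) y) (0, a + b) = 0" if p: "p \<in> ?P - {(\<alpha>, a)}" for p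
  proof -
    obtain c where c: "p = (\<alpha>, c)" "c \<noteq> a" "comp x (\<alpha>, c) \<noteq> 0" using p x
      by (cases p) (simp add: L_iff, metis)
    then have "lt c a" using a by blast
    then have "lt (c + (b - c)) (a + (b - c))" by (rule lt(4))
    then have less: "lt b (a + b - c)" by (simp add: algebra_simps)
    have "comp y (- \<alpha>, a + b - c) = 0"
    proof (rule ccontr)
      assume "comp y (- \<alpha>, a + b - c) \<noteq> 0"
      then have "a + b - c = b \<or> lt (a + b - c) b" using b by blast
      then show False using less asympD[OF lt(2)] by metis
    qed
    then show ?thesis
      using comp_br[OF comp_in[of x \<alpha> c], of y "- \<alpha>" "a + b - c"] c by simp
  qed
  have "br x y = (\<Sum>p\<in>?P. br (comp x p) y)"
    unfolding br_simps(9)[symmetric] by (rule arg_cong[OF sum_comp])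
  then have "comp (br x y) (0, a + b) = (\<Sum>p\<in>?P. comp (br (comp x p) y) (0, a + b))"
    unfolding comp_sum[symmetric] by (rule arg_cong)
  also have "\<dots> = comp (br (comp x (\<alpha>, a)) y) (0, a + b) + (\<Sum>p\<in>?P - {(\<alpha>, a)}. comp (br (comp x p) y) (0, a + b))"
    by (rule sum.remove) (use finite_comp a in auto)
  also have "(\<Sum>p\<in>?P - {(\<alpha>, a)}. comp (br (comp x p) y) (0, a + b)) = 0"
    by (rule sum.neutral) (use other in blast)
  finally have "comp (br x y) (0, a + b) = comp (br (comp x (\<alpha>, a)) y) (0, a + b)" by (simp only: add_0_right)
  also have "\<dots> = br (comp x (\<alpha>, a)) (comp y (- \<alpha>, b))"
    using comp_br[OF comp_in[of x \<alpha> a], of y "- \<alpha>" b] by simp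
  also have "\<dots> \<noteq> 0" by (rule br_opposite_nonzero[OF \<alpha> comp_in a(1) comp_in b(1)])
  finally have "a + b = 0" using comp_hom[OF d(1), of "(0, a + b)"] by (auto split: if_splits)
  then show ?thesis using a b by blast
qed

text \<open>Greatest and lowest degrees of x and y both add up to 0, which leaves no gap between
  them. The criterion mentions only root spaces and the component of degree (0, 0), so it can be
  moved from one grading to another.\<close>

lemma homogeneous_of_bracket:
  assumes \<alpha>: "\<alpha> \<in> R" and x: "x \<in> L \<alpha>" and y: "y \<in> L (- \<alpha>)" and d: "br x y \<in> G 0 0" "br x y \<noteq> 0"
  shows "\<exists>l. x \<in> G \<alpha> l"
proof -
  note lex = transp_lex_less asymp_lex_less totalp_lex_less
  obtain a b where ab: "a + b = 0" "comp x (\<alpha>, a) \<noteq> 0" "comp y (- \<alpha>, b) \<noteq> 0"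
    "\<And>c. comp x (\<alpha>, c) \<noteq> 0 \<Longrightarrow> c = a \<or> lex_less c a" "\<And>c. comp y (- \<alpha>, c) \<noteq> 0 \<Longrightarrow> c = b \<or> lex_less c b"
    using leading_degrees[OF lex lex_less_add assms] by blast
  have rev_order: "transp lex_less\<inverse>\<inverse>" "asymp lex_less\<inverse>\<inverse>" "totalp lex_less\<inverse>\<inverse>"
    using lex by simp_all
  have lex_less_add': "lex_less\<inverse>\<inverse> (a + c) (b + c)" if "lex_less\<inverse>\<inverse> a b" for a b c
    using that lex_less_add[of b a c] by simp
  obtain a' b' where ab': "a' + b' = 0" "comp x (\<alpha>, a') \<noteq> 0" "comp y (- \<alpha>, b') \<noteq> 0"
    "\<And>c. comp x (\<alpha>, c) \<noteq> 0 \<Longrightarrow> c = a' \<or> lex_less a' c" "\<And>c. comp y (- \<alpha>, c) \<noteq> 0 \<Longrightarrow> c = b' \<or> lex_less b' c"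
    using leading_degrees[of "lex_less\<inverse>\<inverse>", OF rev_order lex_less_add' assms] unfolding conversep_iff by blast
  have irrefl: "\<not> lex_less c c" for c using asympD[OF lex(2)] by blast
  \<comment> \<open>If a' were below a, then a' + b' would be below a + b' and hence below a + b,
    although both sums are 0.\<close>
  have "a' = a"
  proof (rule ccontr)
    assume "a' \<noteq> a"
    then have "lex_less a' a" using ab(4) ab'(2) by blast
    then have "lex_less (a' + b') (a + b')" by (rule lex_less_add)
    moreover have "b' = b \<or> lex_less b' b" using ab(5) ab'(3) by blast
    then have "a + b' = a + b \<or> lex_less (a + b') (a + b)" using lex_less_add[of b' b a] by (auto simp: add.commute)
    ultimately have "lex_less (a' + b') (a + b)" using transpD[OF lex(1)] by metis
    then show False using ab(1) ab'(1) irrefl by simp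
  qed
  have "comp x (\<alpha>, c) = 0" if "c \<noteq> a" for c
    using ab(4)[of c] ab'(4)[of c] that \<open>a' = a\<close> asympD[OF lex(2), of c a] by blast
  then have "comp x p = comp (comp x (\<alpha>, a)) p" for p
    using x comp_hom[OF comp_in[of x \<alpha> a], of p] unfolding L_iff by (cases p) (metis prod.inject)
  then have "x = comp x (\<alpha>, a)" by (rule comp_eqI)
  then show ?thesis using comp_in[of x \<alpha> a] by metis
qed

section \<open>Eigenvalues of the component of degree (0, 0) distinguish roots\<close>

lemma weight_L: assumes "weight d w" "\<beta> \<in> Q" "x \<in> L \<beta>" shows "br d x = sc (w \<beta>) x"
proof -
  have "(\<Union>l. G \<beta> l) \<subseteq> {x. br d x = sc (w \<beta>) x}" using assms by (auto simp: weight_def)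
  then have "L \<beta> \<subseteq> {x. br d x = sc (w \<beta>) x}" unfolding gcomp_root_def
    by (rule span_minimal) (auto simp: subspace_def scale_right_distrib scale_left_commute)
  then show ?thesis using assms(3) by blast
qed

lemma weights_separate:
  assumes "x \<in> Q" "\<And>d w. d \<in> G 0 0 \<Longrightarrow> weight d w \<Longrightarrow> w x = 0" shows "x = 0"
proof (rule cartan_separates[OF assms(1)])
  fix \<alpha> assume \<alpha>: "\<alpha> \<in> R"
  obtain d where "d \<in> G 0 0" "weight d (\<lambda>\<beta>. of_int (pairing \<beta> \<alpha>))" using weight_coroot[OF \<alpha>] by metis
  then have "pairing x \<alpha> = 0" using assms(2) by fastforce
  then show "cartan x \<alpha> = 0" using pairing[OF assms(1) \<alpha>] by simp
qed

lemma weight_diff: assumes "weight d w" "x \<in> Q" "y \<in> Q" shows "w (x - y) = w x - w y"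
proof -
  have "w ((x - y) + y) = w (x - y) + w y" using assms subgroup_gen_diff[of x D y] unfolding weight_def by blast
  then show ?thesis by simp
qed

end

section \<open>Two gradings with the same component of degree (0, 0)\<close>

locale two_tori = A: lie_torus_on sc br D n G + B: lie_torus_on sc br D' n' G'
  for sc :: "'k::field_char_0 \<Rightarrow> 'a::ab_group_add \<Rightarrow> 'a" and br :: "'a \<Rightarrow> 'a \<Rightarrow> 'a"
    and D n G D' n' G' +
  assumes same: "G 0 0 = G' 0 0"
begin

lemma sym: "two_tori sc br D' n' G' D n G"
  by unfold_locales (simp add: same)

lemma A_weight_separates:
  assumes "\<beta> \<in> A.Q" "\<gamma> \<in> B.Q" "\<gamma>' \<in> B.Q"
    and "\<And>d w w'. d \<in> G 0 0 \<Longrightarrow> A.weight d w \<Longrightarrow> B.weight d w' \<Longrightarrow> w \<beta> = w' \<gamma>"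
    and "\<And>d w w'. d \<in> G 0 0 \<Longrightarrow> A.weight d w \<Longrightarrow> B.weight d w' \<Longrightarrow> w \<beta> = w' \<gamma>'"
  shows "\<gamma> = \<gamma>'"
proof -
  have "\<gamma> - \<gamma>' = 0"
  proof (rule B.weights_separate)
    show "\<gamma> - \<gamma>' \<in> B.Q" using assms by (intro subgroup_gen_diff)
    fix d w' assume d: "d \<in> G' 0 0" "B.weight d w'"
    obtain w where "A.weight d w" using A.weight_exists[of d] d same by auto
    then have "w' \<gamma> = w' \<gamma>'" using assms(4,5) d same by metis
    then show "w' (\<gamma> - \<gamma>') = 0" using B.weight_diff[OF d(2) assms(2,3)] by simp
  qed
  then show ?thesis by simp
qed

text \<open>Bracketing with d in the common component preserves every degree of the second grading.
  Each nonzero second component of a vector in \<open>A.L \<beta>\<close> is thus an eigenvector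
  with the eigenvalue of \<beta>, so all these components belong to one and the same root
  \<gamma>.\<close>

lemma root_space_incl:
  assumes \<beta>: "\<beta> \<in> D"
  shows "\<exists>\<gamma>\<in>D'. A.L \<beta> \<subseteq> B.L \<gamma> \<and>
    (\<forall>d w w'. d \<in> G 0 0 \<longrightarrow> A.weight d w \<longrightarrow> B.weight d w' \<longrightarrow> w \<beta> = w' \<gamma>)"
proof -
  define P where "P \<gamma> \<longleftrightarrow> (\<forall>d w w'. d \<in> G 0 0 \<longrightarrow> A.weight d w \<longrightarrow> B.weight d w' \<longrightarrow> w \<beta> = w' \<gamma>)" for \<gamma>
  have comp: "\<gamma> \<in> D' \<and> P \<gamma>" if x: "x \<in> A.L \<beta>" and nz: "B.comp x (\<gamma>, l) \<noteq> 0" for x \<gamma> l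
  proof
    show D': "\<gamma> \<in> D'" using B.comp_in[of x \<gamma> l] nz B.LT1 by blast
    show "P \<gamma>" unfolding P_def
    proof (intro allI impI)
      fix d w w' assume d: "d \<in> G 0 0" and w: "A.weight d w" and w': "B.weight d w'"
      have "d \<in> G' 0 0" using d same by simp
      from B.comp_br[OF this, of x \<gamma> l] have "B.comp (br d x) (\<gamma>, l) = br d (B.comp x (\<gamma>, l))" by simp
      also have "\<dots> = sc (w' \<gamma>) (B.comp x (\<gamma>, l))"
        using w' B.comp_in[of x \<gamma> l] B.D_subset_Q[OF D'] unfolding B.weight_def by blast
      also have "br d x = sc (w \<beta>) x" by (rule A.weight_L[OF w A.D_subset_Q[OF \<beta>] x])
      finally show "w \<beta> = w' \<gamma>" using nz by simp
    qed
  qed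
  have nonzero: "\<exists>\<gamma> l. B.comp x (\<gamma>, l) \<noteq> 0" if "x \<noteq> 0" for x
  proof (rule ccontr)
    assume "\<not> ?thesis"
    then have "B.comp x p = B.comp 0 p" for p by (cases p) simp
    then show False using B.comp_eqI that by blast
  qed
  obtain l x0 where x0: "x0 \<in> G \<beta> l" "x0 \<noteq> 0" using \<beta> A.LT1 A.G_nontrivial by metis
  obtain \<gamma> l' where \<gamma>: "B.comp x0 (\<gamma>, l') \<noteq> 0" using nonzero[OF x0(2)] by blast
  have P: "\<gamma> \<in> D'" "P \<gamma>" using comp[OF A.G_subset_L[OF x0(1)] \<gamma>] by auto
  have "A.L \<beta> \<subseteq> B.L \<gamma>"
  proof
    fix x assume x: "x \<in> A.L \<beta>"
    have "\<gamma>' = \<gamma>" if "B.comp x (\<gamma>', l) \<noteq> 0" for \<gamma>' l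
      by (rule A_weight_separates[OF A.D_subset_Q[OF \<beta>]])
        (use comp[OF x that] P B.D_subset_Q in \<open>unfold P_def, blast+\<close>)
    then show "x \<in> B.L \<gamma>" unfolding B.L_iff by metis
  qed
  then show ?thesis using P unfolding P_def by blast
qed

text \<open>Having equal eigenvalues is an additive relation between the two root lattices and, by
  separation, one-to-one in both directions. It contains the graph of the bijection of roots, which
  therefore extends to an isomorphism of the lattices.\<close>

lemma root_iso:
  obtains r where "is_group_iso A.Q B.Q r" "r ` D = D'" "\<And>\<beta>. \<beta> \<in> D \<Longrightarrow> A.L \<beta> = B.L (r \<beta>)"
proof -
  interpret S: two_tori sc br D' n' G' D n G by (rule sym)
  define W where "W \<beta> \<gamma> \<longleftrightarrow> (\<forall>d w w'. d \<in> G 0 0 \<longrightarrow> A.weight d w \<longrightarrow> B.weight d w' \<longrightarrow> w \<beta> = w' \<gamma>)" for \<beta> \<gamma>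
  have W_uniq: "\<gamma> = \<gamma>'" if "W \<beta> \<gamma>" "W \<beta> \<gamma>'" "\<beta> \<in> A.Q" "\<gamma> \<in> B.Q" "\<gamma>' \<in> B.Q" for \<beta> \<gamma> \<gamma>'
    by (rule A_weight_separates[OF that(3-5)]) (use that(1,2) in \<open>unfold W_def, blast+\<close>)
  have W_uniq': "\<beta> = \<beta>'" if "W \<beta> \<gamma>" "W \<beta>' \<gamma>" "\<gamma> \<in> B.Q" "\<beta> \<in> A.Q" "\<beta>' \<in> A.Q" for \<beta> \<beta>' \<gamma>
    by (rule S.A_weight_separates[OF that(3-5)]) (use that(1,2) same in \<open>unfold W_def, metis+\<close>)
  have ex: "\<exists>\<gamma>\<in>D'. A.L \<beta> \<subseteq> B.L \<gamma> \<and> W \<beta> \<gamma>" if "\<beta> \<in> D" for \<beta>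
    using root_space_incl[OF that] unfolding W_def .
  have ex': "\<exists>\<beta>\<in>D. B.L \<gamma> \<subseteq> A.L \<beta> \<and> W \<beta> \<gamma>" if "\<gamma> \<in> D'" for \<gamma>
    using S.root_space_incl[OF that] same unfolding W_def by metis
  obtain s where s: "\<And>\<beta>. \<beta> \<in> D \<Longrightarrow> s \<beta> \<in> D' \<and> A.L \<beta> \<subseteq> B.L (s \<beta>) \<and> W \<beta> (s \<beta>)" using ex by metis
  have eq: "A.L \<beta> = B.L (s \<beta>)" if b: "\<beta> \<in> D" for \<beta>
  proof -
    obtain \<beta>' where \<beta>': "\<beta>' \<in> D" "B.L (s \<beta>) \<subseteq> A.L \<beta>'" "W \<beta>' (s \<beta>)" using ex' s[OF b] by metis
    then have "\<beta>' = \<beta>" using W_uniq'[of \<beta>' "s \<beta>" \<beta>] s[OF that] that A.D_subset_Q B.D_subset_Q by blast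
    then show ?thesis using \<beta>' s[OF that] by blast
  qed
  have onto: "s ` D = D'"
  proof
    show "D' \<subseteq> s ` D"
    proof
      fix \<gamma> assume \<gamma>: "\<gamma> \<in> D'"
      obtain \<beta> where \<beta>: "\<beta> \<in> D" "W \<beta> \<gamma>" using ex'[OF \<gamma>] by blast
      then have "s \<beta> = \<gamma>" using W_uniq[of \<beta> "s \<beta>" \<gamma>] s[OF \<beta>(1)] \<gamma> A.D_subset_Q B.D_subset_Q by blast
      then show "\<gamma> \<in> s ` D" using \<beta>(1) by blast
    qed
  qed (use s in blast)
  define T where "T = (\<lambda>\<beta>. (\<beta>, s \<beta>)) ` D"
  define H where "H = {(x, y). x \<in> A.Q \<and> y \<in> B.Q \<and> W x y}"
  have Wadd: "W (x + x') (y + y')" if "W x y" "W x' y'" "x \<in> A.Q" "x' \<in> A.Q" "y \<in> B.Q" "y' \<in> B.Q" for x x' y y'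
    unfolding W_def
  proof (intro allI impI)
    fix d w w' assume d: "d \<in> G 0 0" "A.weight d w" "B.weight d w'"
    then have "w x = w' y" "w x' = w' y'" using that(1,2) unfolding W_def by blast+
    moreover have "w (x + x') = w x + w x'" "w' (y + y') = w' y + w' y'"
      using d(2,3) that(3-6) unfolding A.weight_def B.weight_def by blast+
    ultimately show "w (x + x') = w' (y + y')" by simp
  qed
  have W0: "W 0 0"
    unfolding W_def
  proof (intro allI impI)
    fix d w w' assume "A.weight d w" "B.weight d w'"
    then have "w 0 = 0" "w' 0 = 0"
      using A.weight_diff[of d w 0 0] B.weight_diff[of d w' 0 0] subgroup_gen_zero by auto
    then show "w 0 = w' 0" by simp
  qed
  have Wminus: "W (- x) (- y)" if "W x y" "x \<in> A.Q" "y \<in> B.Q" for x y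
    unfolding W_def
  proof (intro allI impI)
    fix d w w' assume d: "d \<in> G 0 0" "A.weight d w" "B.weight d w'"
    then have "w 0 = w' 0" "w x = w' y" using W0 that unfolding W_def by blast+
    then show "w (- x) = w' (- y)"
      using A.weight_diff[OF d(2) subgroup_gen_zero that(2)] B.weight_diff[OF d(3) subgroup_gen_zero that(3)]
      by (simp only: diff_0)
  qed
  have sub: "subgroup_gen T \<subseteq> H"
  proof (rule subgroup_gen_least)
    show "T \<subseteq> H" using s A.D_subset_Q B.D_subset_Q unfolding T_def H_def by blast
    show "0 \<in> H" unfolding H_def zero_prod_def using W0 subgroup_gen_zero by blast
    show "p + q \<in> H" if "p \<in> H" "q \<in> H" for p q
      using that unfolding H_def plus_prod_def by (auto simp only: prod.case mem_Collect_eq split_beta fst_conv snd_conv intro: subgroup_gen_add Wadd)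
    show "- p \<in> H" if "p \<in> H" for p
      using that unfolding H_def uminus_prod_def by (auto simp only: prod.case mem_Collect_eq split_beta fst_conv snd_conv intro: subgroup_gen_minus Wminus)
  qed
  have z1: "y = 0" if "(0, y) \<in> subgroup_gen T" for y
    using sub that W_uniq[OF _ W0] subgroup_gen_zero unfolding H_def by blast
  have z2: "x = 0" if "(x, 0) \<in> subgroup_gen T" for x
    using sub that W_uniq'[OF _ W0] subgroup_gen_zero unfolding H_def by blast
  obtain r where r: "\<And>x y. (x, y) \<in> subgroup_gen T \<Longrightarrow> r x = y"
    "is_group_iso (subgroup_gen (fst ` T)) (subgroup_gen (snd ` T)) r" using graph_iso[OF z1 z2] by blast
  have "fst ` T = D" "snd ` T = D'" using onto by (auto simp: T_def image_image)
  moreover have rs: "r \<beta> = s \<beta>" if "\<beta> \<in> D" for \<beta>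
    by (rule r(1)) (use that in \<open>auto simp: T_def intro: subgroup_gen_base\<close>)
  ultimately show thesis using that[of r] r(2) eq onto by (metis (no_types, lifting) image_cong)
qed

text \<open>The vector e of a triple brackets with f to a nonzero element of the common component,
  so it is homogeneous for the second grading too. Both homogeneous spaces are lines through
  e.\<close>

lemma same_degree:
  assumes \<alpha>: "\<alpha> \<in> A.R" and \<alpha>': "\<alpha>' \<in> B.R" and L: "A.L \<alpha> = B.L \<alpha>'" "A.L (- \<alpha>) = B.L (- \<alpha>')" and G: "G \<alpha> l \<noteq> {0}"
  shows "\<exists>l'. G \<alpha> l = G' \<alpha>' l'"
proof -
  obtain e f where t: "A.triple \<alpha> l e f" "e \<noteq> 0" and e: "G \<alpha> l = range (\<lambda>c. sc c e)"
    using A.triple_exists[OF \<alpha> G] by metis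
  have ef: "e \<in> G \<alpha> l" "f \<in> G (- \<alpha>) (- l)" using t by (auto simp: A.triple_def)
  have "br e f \<in> G' 0 0" using A.br_G[OF ef] same by simp
  moreover have "br e f \<noteq> 0" by (rule A.triple_nonzero[OF t \<alpha>])
  moreover have "e \<in> B.L \<alpha>'" "f \<in> B.L (- \<alpha>')" using ef A.G_subset_L L by auto
  ultimately obtain l' where l': "e \<in> G' \<alpha>' l'" using B.homogeneous_of_bracket[OF \<alpha>'] by blast
  then have "G' \<alpha>' l' \<noteq> {0}" using t(2) by blast
  then obtain e' where e': "G' \<alpha>' l' = range (\<lambda>c. sc c e')" using B.triple_exists[OF \<alpha>'] by metis
  then obtain c where c: "e = sc c e'" using l' by auto
  then have "c \<noteq> 0" using t(2) by auto
  have "G \<alpha> l \<subseteq> G' \<alpha>' l'" unfolding e e' c by auto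
  moreover have "sc a e' = sc (a / c) e" for a using c \<open>c \<noteq> 0\<close> by simp
  then have "G' \<alpha>' l' \<subseteq> G \<alpha> l" unfolding e e' by blast
  ultimately show ?thesis by blast
qed

lemma ex_isotopy:
  "\<exists>r \<epsilon> s. is_group_iso A.Q B.Q r \<and> is_group_iso (Zn n) (Zn n') \<epsilon> \<and> is_group_hom A.Q (Zn n') s \<and>
    (\<forall>\<alpha>\<in>A.Q. \<forall>l\<in>Zn n. G \<alpha> l = G' (r \<alpha>) (\<epsilon> l + s \<alpha>))"
proof -
  interpret S: two_tori sc br D' n' G' D n G by (rule sym)
  obtain r where r: "is_group_iso A.Q B.Q r" "r ` D = D'" and L: "\<And>\<beta>. \<beta> \<in> D \<Longrightarrow> A.L \<beta> = B.L (r \<beta>)"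
    using root_iso by blast
  have rh: "is_group_hom A.Q B.Q r" using r(1) by (simp add: is_group_iso_def)
  have r0: "r 0 = 0" by (rule group_hom_zero[OF rh subgroup_gen_zero])
  have rminus: "r (- x) = - r x" if "x \<in> A.Q" for x by (rule group_hom_minus[OF rh that])
  have rinj: "inj_on r A.Q" using r(1) by (simp add: is_group_iso_def bij_betw_def)
  have rR: "r \<alpha> \<in> B.R" if "\<alpha> \<in> A.R" for \<alpha>
    using that r(2) r0 inj_onD[OF rinj, of \<alpha> 0] subgroup_gen_zero[of D] A.D_subset_Q by auto
  have deg: "\<exists>l'. G \<alpha> l = G' (r \<alpha>) l'" if "\<alpha> \<in> A.R" "G \<alpha> l \<noteq> {0}" for \<alpha> l
    by (rule same_degree[OF that(1) rR[OF that(1)] _ _ that(2)])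
      (use that L A.minus_D[of \<alpha>] rminus[of \<alpha>] A.D_subset_Q in auto)
  have deg': "\<exists>l. G' (r \<alpha>) l' = G \<alpha> l" if "\<alpha> \<in> A.R" "G' (r \<alpha>) l' \<noteq> {0}" for \<alpha> l'
    by (rule S.same_degree[OF rR[OF that(1)] that(1) _ _ that(2)])
      (use that L A.minus_D[of \<alpha>] rminus[of \<alpha>] A.D_subset_Q in auto)
  define Su where "Su \<alpha> = {l. G \<alpha> l \<noteq> {0}}" for \<alpha>
  obtain \<tau> where \<tau>: "\<And>\<alpha> l. \<alpha> \<in> A.R \<Longrightarrow> l \<in> Su \<alpha> \<Longrightarrow> G \<alpha> l = G' (r \<alpha>) (\<tau> \<alpha> l)"
    using deg unfolding Su_def mem_Collect_eq by metis
  have \<tau>_eqI: "\<tau> \<alpha> l = l'" if "\<alpha> \<in> A.R" "x \<in> G \<alpha> l" "x \<noteq> 0" "x \<in> G' \<gamma> l'" for \<alpha> l x \<gamma> l'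
  proof -
    have "l \<in> Su \<alpha>" using that unfolding Su_def by blast
    then have "x \<in> G' (r \<alpha>) (\<tau> \<alpha> l)" using \<tau> that by blast
    then show ?thesis using B.G_disjoint that by blast
  qed
  have Su_Zn: "l \<in> Zn n" if "l \<in> Su \<alpha>" for l \<alpha> using that A.G_outside unfolding Su_def by blast
  \<comment> \<open>A power of \<open>br g\<close> applied to v is homogeneous for both gradings if
    g and v are; being nonzero, it reveals the value of \<tau> at its degree.\<close>
  have string: "\<mu> + of_int (int k) * \<nu> \<in> Su \<delta> \<and> \<tau> \<delta> (\<mu> + of_int (int k) * \<nu>) = \<tau> \<beta> \<mu> + of_int (int k) * \<nu>'"
    if g: "g \<in> G \<gamma> \<nu>" "g \<in> G' \<gamma>' \<nu>'" and v: "v \<in> G \<beta> \<mu>" "v \<noteq> 0" and \<beta>: "\<beta> \<in> A.R"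
      and nz: "(br g ^^ k) v \<noteq> 0" and \<delta>: "\<delta> = \<beta> + of_int (int k) * \<gamma>" "\<delta> \<in> A.R"
    for g \<gamma> \<nu> \<gamma>' \<nu>' v \<beta> \<mu> k \<delta>
  proof
    have 1: "(br g ^^ k) v \<in> G \<delta> (\<mu> + of_int (int k) * \<nu>)" using A.power_br_G[OF g(1) v(1)] \<delta> by blast
    then show "\<mu> + of_int (int k) * \<nu> \<in> Su \<delta>" using nz unfolding Su_def by blast
    have "v \<in> G' (r \<beta>) (\<tau> \<beta> \<mu>)" using v \<tau>[OF \<beta>] unfolding Su_def by blast
    from \<tau>_eqI[OF \<delta>(2) 1 nz B.power_br_G[OF g(2) this]]
    show "\<tau> \<delta> (\<mu> + of_int (int k) * \<nu>) = \<tau> \<beta> \<mu> + of_int (int k) * \<nu>'" .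
  qed
  have \<tau>_reflect: "\<mu> - of_int m * l \<in> Su (reflect \<alpha> \<beta>) \<and>
      \<tau> (reflect \<alpha> \<beta>) (\<mu> - of_int m * l) = \<tau> \<beta> \<mu> - of_int m * \<tau> \<alpha> l"
    if \<alpha>: "\<alpha> \<in> A.R" and \<beta>: "\<beta> \<in> A.R" and l: "l \<in> Su \<alpha>" and \<mu>: "\<mu> \<in> Su \<beta>" and m: "real_of_int m = cartan \<beta> \<alpha>"
    for \<alpha> \<beta> l \<mu> m
  proof -
    obtain e f where t: "A.triple \<alpha> l e f" "e \<noteq> 0" using A.triple_exists[OF \<alpha>] l unfolding Su_def by blast
    have \<alpha>V: "\<alpha> \<in> A.V" using \<alpha> by auto
    have nz: "br e f \<noteq> 0" "f \<noteq> 0" using A.triple_nonzero[OF t \<alpha>] by auto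
    have ef: "e \<in> G \<alpha> l" "f \<in> G (- \<alpha>) (- l)" using t by (auto simp: A.triple_def)
    have e': "e \<in> G' (r \<alpha>) (\<tau> \<alpha> l)" using \<tau>[OF \<alpha> l] ef by blast
    have "- l \<in> Su (- \<alpha>)" using nz ef unfolding Su_def by blast
    then have f'': "f \<in> G' (r (- \<alpha>)) (\<tau> (- \<alpha>) (- l))" using \<tau>[OF A.minus_R[OF \<alpha>]] ef by blast
    \<comment> \<open>The nonzero bracket of e and f has degree (0, 0) for both gradings, which
      makes the second degrees of e and f opposite.\<close>
    have "br e f \<in> G' 0 0" using A.br_G[OF ef] same by simp
    then have "\<tau> \<alpha> l + \<tau> (- \<alpha>) (- l) = 0" using B.G_disjoint[OF B.br_G[OF e' f''] _ nz(1)] by blast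
    then have "\<tau> (- \<alpha>) (- l) = - \<tau> \<alpha> l" by (metis add.commute eq_neg_iff_add_eq_0)
    with f'' have f': "f \<in> G' (r (- \<alpha>)) (- \<tau> \<alpha> l)" by (simp only:)
    obtain v where v: "v \<in> G \<beta> \<mu>" "v \<noteq> 0" using \<mu> A.G_nontrivial unfolding Su_def by blast
    have refl: "reflect \<alpha> \<beta> = \<beta> - of_int m * \<alpha>" unfolding reflect_def m[symmetric] rscale_of_int ..
    have R: "reflect \<alpha> \<beta> \<in> A.R" by (rule A.reflect_in[OF \<alpha> \<beta>])
    \<comment> \<open>The reflected root is reached by m applications of f if m is nonnegative, and
      by -m applications of e otherwise.\<close>
    show ?thesis
    proof (cases "m \<ge> 0")
      case True
      define k where "k = nat m"
      have k: "m = int k" using True by (simp add: k_def)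
      have nz: "(br f ^^ k) v \<noteq> 0" by (rule A.string_nonzero[OF t(1) \<alpha> v]) (use m k in simp)
      have \<delta>: "reflect \<alpha> \<beta> = \<beta> + of_int (int k) * - \<alpha>" unfolding refl k by (simp only: mult_minus_right add_uminus_conv_diff)
      show ?thesis using string[OF ef(2) f' v \<beta> nz \<delta> R] unfolding k by (simp only: mult_minus_right add_uminus_conv_diff)
    next
      case False
      define k where "k = nat (- m)"
      have k: "m = - int k" using False by (simp add: k_def)
      have c: "cartan \<beta> (- \<alpha>) = int k" using A.cartan_minus[OF \<alpha>V, of \<beta>] m k by simp
      have nz: "(br e ^^ k) v \<noteq> 0" by (rule A.string_nonzero[OF A.triple_swap[OF t(1) \<alpha>V] A.minus_R[OF \<alpha>] v c])
      have \<delta>: "reflect \<alpha> \<beta> = \<beta> + of_int (int k) * \<alpha>" unfolding refl k by (simp only: of_int_minus mult_minus_left diff_minus_eq_add)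
      show ?thesis using string[OF ef(1) e' v \<beta> nz \<delta> R] unfolding k by (simp only: of_int_minus mult_minus_left diff_minus_eq_add)
    qed
  qed
  have \<tau>_inj: "l = l2" if \<alpha>: "\<alpha> \<in> A.R" and l: "l \<in> Su \<alpha>" "l2 \<in> Su \<alpha>" "\<tau> \<alpha> l = \<tau> \<alpha> l2" for \<alpha> l l2
  proof -
    have "G \<alpha> l = G \<alpha> l2" using \<tau>[OF \<alpha>] l by metis
    moreover obtain x where "x \<in> G \<alpha> l" "x \<noteq> 0" using l(1) A.G_nontrivial unfolding Su_def by blast
    ultimately show ?thesis using A.G_disjoint by blast
  qed
  have \<tau>_Zn: "\<tau> \<alpha> l \<in> Zn n'" if "\<alpha> \<in> A.R" "l \<in> Su \<alpha>" for \<alpha> l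
    using that \<tau>[OF that] B.G_outside[of "r \<alpha>" "\<tau> \<alpha> l"] unfolding Su_def by blast
  have J0: "0 \<in> Su \<alpha>" if "\<alpha> \<in> A.J" for \<alpha> using A.LT2i[OF that] unfolding Su_def by blast
  have refl0: "\<tau> (reflect \<alpha> \<beta>) 0 = \<tau> \<beta> 0 - of_int m * \<tau> \<alpha> 0"
    if "\<alpha> \<in> A.J" "\<beta> \<in> A.J" "real_of_int m = cartan \<beta> \<alpha>" for \<alpha> \<beta> m
    using \<tau>_reflect[OF A.J_subset[OF that(1)] A.J_subset[OF that(2)] J0[OF that(1)] J0[OF that(2)] that(3)]
    by (simp only: mult_zero_right diff_zero)
  define P where "P = {(\<alpha>, \<tau> \<alpha> 0) | \<alpha>. \<alpha> \<in> A.J}"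
  have "y = 0" if "(0, y) \<in> subgroup_gen P" for y
    using A.reflection_equivariant_extends[of "\<lambda>\<alpha>. \<tau> \<alpha> 0", OF refl0] that unfolding P_def by blast
  then obtain s where s: "\<And>x y. (x, y) \<in> subgroup_gen P \<Longrightarrow> s x = y"
    and sh: "is_group_hom (subgroup_gen (fst ` P)) (subgroup_gen (snd ` P)) s" using graph_hom[of P] by blast
  have fstP: "fst ` P = A.J" unfolding P_def by force
  have sJ: "s \<alpha> = \<tau> \<alpha> 0" if "\<alpha> \<in> A.J" for \<alpha>
    by (rule s[OF subgroup_gen_base]) (use that in \<open>unfold P_def, blast\<close>)
  have Zn': "0 \<in> Zn n'" "x \<in> Zn n' \<Longrightarrow> y \<in> Zn n' \<Longrightarrow> x + y \<in> Zn n'" "x \<in> Zn n' \<Longrightarrow> - x \<in> Zn n'" for x y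
    by (auto simp: Zn_def)
  have "snd ` P \<subseteq> Zn n'" unfolding P_def using \<tau>_Zn[OF A.J_subset J0] by force
  then have "subgroup_gen (snd ` P) \<subseteq> Zn n'" by (rule subgroup_gen_least) (use Zn' in auto)
  then have sh': "is_group_hom A.Q (Zn n') s" using sh unfolding fstP A.Q_eq_J[symmetric] is_group_hom_def by blast
  have sh2: "is_group_hom A.Q (subgroup_gen (snd ` P)) s" using sh unfolding fstP A.Q_eq_J[symmetric] .
  \<comment> \<open>Since s is additive it obeys the same reflection law as \<tau>; the difference
    keeps that law and vanishes at degree 0 of indivisible roots.\<close>
  define \<sigma> where "\<sigma> \<alpha> l = \<tau> \<alpha> l - s \<alpha>" for \<alpha> l
  have s_reflect: "s (reflect \<alpha> \<beta>) = s \<beta> - of_int m * s \<alpha>"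
    if "\<alpha> \<in> A.R" "\<beta> \<in> A.R" "real_of_int m = cartan \<beta> \<alpha>" for \<alpha> \<beta> m
  proof -
    have Q: "\<alpha> \<in> A.Q" "\<beta> \<in> A.Q" using that A.D_subset_Q by auto
    have "reflect \<alpha> \<beta> = \<beta> + of_int (- m) * \<alpha>"
      unfolding reflect_def that(3)[symmetric] rscale_of_int
      by (simp only: of_int_minus mult_minus_left add_uminus_conv_diff)
    moreover have "s (\<beta> + of_int (- m) * \<alpha>) = s \<beta> + of_int (- m) * s \<alpha>"
      using sh' Q of_int_times_in_subgroup_gen[OF Q(1), of "- m"] group_hom_of_int_times[OF sh' Q(1), of "- m"]
      unfolding is_group_hom_def by metis
    ultimately show ?thesis by (simp only: of_int_minus mult_minus_left add_uminus_conv_diff)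
  qed
  interpret C: reflection_support D Su \<sigma>
  proof
    show "0 \<in> Su \<alpha>" "\<sigma> \<alpha> 0 = 0" if "\<alpha> \<in> A.J" for \<alpha> using J0[OF that] sJ[OF that] by (auto simp: \<sigma>_def)
    show "inj_on (\<sigma> \<alpha>) (Su \<alpha>)" if "\<alpha> \<in> A.R" for \<alpha>
      using \<tau>_inj[OF that] by (auto simp: \<sigma>_def intro!: inj_onI)
    fix \<alpha> \<beta> l \<mu> m
    assume *: "\<alpha> \<in> A.R" "\<beta> \<in> A.R" "l \<in> Su \<alpha>" "\<mu> \<in> Su \<beta>" "real_of_int m = cartan \<beta> \<alpha>"
    show "\<mu> - of_int m * l \<in> Su (reflect \<alpha> \<beta>) \<and>
       \<sigma> (reflect \<alpha> \<beta>) (\<mu> - of_int m * l) = \<sigma> \<beta> \<mu> - of_int m * \<sigma> \<alpha> l"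
      using \<tau>_reflect[OF *] s_reflect[OF *(1,2,5)] unfolding \<sigma>_def by (simp add: algebra_simps)
  qed
  define T where "T = {(l, \<sigma> \<alpha> l) | \<alpha> l. \<alpha> \<in> A.R \<and> l \<in> Su \<alpha>}"
  obtain \<epsilon> where \<epsilon>: "\<And>x y. (x, y) \<in> subgroup_gen T \<Longrightarrow> \<epsilon> x = y"
    and \<epsilon>iso: "is_group_iso (subgroup_gen (fst ` T)) (subgroup_gen (snd ` T)) \<epsilon>"
    using graph_iso[of T] C.degree_graph unfolding T_def by blast
  have \<epsilon>\<sigma>: "\<epsilon> l = \<sigma> \<alpha> l" if "\<alpha> \<in> A.R" "l \<in> Su \<alpha>" for \<alpha> l
    by (rule \<epsilon>[OF subgroup_gen_base]) (use that in \<open>unfold T_def, blast\<close>)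
  have "fst ` T = {l. \<exists>\<alpha>\<in>A.R. G \<alpha> l \<noteq> {0}}" unfolding T_def Su_def by force
  then have fstT: "subgroup_gen (fst ` T) = Zn n" using A.Zn_generated by simp
  have \<sigma>_in: "\<sigma> \<alpha> l \<in> subgroup_gen (snd ` T)" if "\<alpha> \<in> A.R" "l \<in> Su \<alpha>" for \<alpha> l
    using that unfolding T_def by (intro subgroup_gen_base) force
  have surj_deg: "\<exists>l\<in>Su \<alpha>. \<tau> \<alpha> l = l'" if \<alpha>: "\<alpha> \<in> A.R" and nz: "G' (r \<alpha>) l' \<noteq> {0}" for \<alpha> l'
  proof -
    obtain l where l: "G' (r \<alpha>) l' = G \<alpha> l" using deg'[OF \<alpha> nz] by blast
    obtain x where "x \<in> G' (r \<alpha>) l'" "x \<noteq> 0" using nz B.G_nontrivial by blast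
    then show ?thesis using \<tau>_eqI[OF \<alpha>, of x l "r \<alpha>" l'] l unfolding Su_def by blast
  qed
  \<comment> \<open>(LT2)(i) for the second grading speaks about indivisible roots only. A half of r
    \<alpha> would come from a half of \<alpha>, by additivity and injectivity of r.\<close>
  have rJ: "r \<alpha> \<in> B.J" if "\<alpha> \<in> A.J" for \<alpha>
  proof (rule ccontr)
    have \<alpha>: "\<alpha> \<in> A.R" by (rule A.J_subset[OF that])
    assume "r \<alpha> \<notin> B.J"
    then obtain \<gamma> where \<gamma>: "\<gamma> \<in> B.R" "r \<alpha> = rscale 2 \<gamma>" using rR[OF \<alpha>] by (auto simp: indivisible_roots_def)
    then obtain \<beta> where \<beta>: "\<beta> \<in> D" "\<gamma> = r \<beta>" using r(2) by blast
    have \<beta>Q: "\<beta> \<in> A.Q" using \<beta> A.D_subset_Q by blast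
    have two: "rscale 2 x = x + x" for x by (simp add: fun_eq_iff)
    have "r (\<beta> + \<beta>) = r \<alpha>" using rh \<beta>Q \<gamma> \<beta> two[of \<gamma>] unfolding is_group_hom_def by metis
    then have "\<alpha> = rscale 2 \<beta>"
      using inj_onD[OF rinj, of "\<beta> + \<beta>" \<alpha>] subgroup_gen_add[OF \<beta>Q \<beta>Q] A.D_subset_Q[of \<alpha>] \<alpha> two[of \<beta>] by simp
    moreover have "\<beta> \<noteq> 0" using \<gamma> \<beta> r0 by auto
    ultimately show False using that \<beta>(1) unfolding indivisible_roots_def by blast
  qed
  txt \<open>(LT2)(i) for the second grading: degree 0 occurs in \<open>r \<alpha>\<close>, so \<open>\<tau> \<alpha> 0\<close> lies in the span of \<open>\<sigma>\<close>.\<close>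
  have "snd ` P \<subseteq> subgroup_gen (snd ` T)"
  proof
    fix y assume "y \<in> snd ` P"
    then obtain \<alpha> where \<alpha>: "\<alpha> \<in> A.J" "y = \<tau> \<alpha> 0" unfolding P_def by force
    obtain l where l: "l \<in> Su \<alpha>" "\<tau> \<alpha> l = 0"
      using surj_deg[OF A.J_subset[OF \<alpha>(1)] B.LT2i[OF rJ[OF \<alpha>(1)]]] by blast
    have "y = - \<sigma> \<alpha> l" using l \<alpha> sJ by (simp add: \<sigma>_def)
    then show "y \<in> subgroup_gen (snd ` T)" using subgroup_gen_minus[OF \<sigma>_in[OF A.J_subset[OF \<alpha>(1)] l(1)]] by (simp only:)
  qed
  from subgroup_gen_mono[OF this] have s_in: "s x \<in> subgroup_gen (snd ` T)" if "x \<in> A.Q" for x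
    using sh2 that unfolding is_group_hom_def by blast
  have "subgroup_gen (snd ` T) = Zn n'"
  proof
    have "snd ` T \<subseteq> Zn n'"
    proof
      fix y assume "y \<in> snd ` T"
      then obtain \<alpha> l where y: "y = \<sigma> \<alpha> l" "\<alpha> \<in> A.R" "l \<in> Su \<alpha>" unfolding T_def by force
      have "s \<alpha> \<in> Zn n'" using sh' y(2) A.D_subset_Q unfolding is_group_hom_def by blast
      then show "y \<in> Zn n'" using \<tau>_Zn[OF y(2,3)] y(1) by (auto simp: \<sigma>_def Zn_def)
    qed
    then show "subgroup_gen (snd ` T) \<subseteq> Zn n'" by (rule subgroup_gen_least) (use Zn' in auto)
    have "l' \<in> subgroup_gen (snd ` T)" if \<gamma>: "\<gamma> \<in> B.R" "G' \<gamma> l' \<noteq> {0}" for \<gamma> l'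
    proof -
      obtain \<alpha> where \<alpha>: "\<alpha> \<in> D" "\<gamma> = r \<alpha>" using \<gamma>(1) r(2) by blast
      then have R: "\<alpha> \<in> A.R" using \<gamma>(1) r0 by auto
      obtain l where l: "l \<in> Su \<alpha>" "\<tau> \<alpha> l = l'" using surj_deg[OF R] \<gamma> \<alpha> by blast
      have "\<sigma> \<alpha> l + s \<alpha> \<in> subgroup_gen (snd ` T)"
        using \<sigma>_in[OF R l(1)] s_in A.D_subset_Q[OF \<alpha>(1)] by (intro subgroup_gen_add)
      then show ?thesis using l by (simp add: \<sigma>_def)
    qed
    then show "Zn n' \<subseteq> subgroup_gen (snd ` T)" unfolding B.Zn_generated[symmetric]
      by (intro subgroup_gen_mono) blast
  qed
  then have \<epsilon>iso': "is_group_iso (Zn n) (Zn n') \<epsilon>" using \<epsilon>iso fstT by simp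
  have \<epsilon>h: "is_group_hom (Zn n) (Zn n') \<epsilon>" and \<epsilon>inj: "inj_on \<epsilon> (Zn n)"
    using \<epsilon>iso' by (auto simp: is_group_iso_def bij_betw_def)
  have root: "G \<alpha> l = G' (r \<alpha>) (\<epsilon> l + s \<alpha>)" if "\<alpha> \<in> A.R" "l \<in> Su \<alpha>" for \<alpha> l
    using \<tau>[OF that] \<epsilon>\<sigma>[OF that] by (simp add: \<sigma>_def)
  have incl: "G \<alpha> l \<subseteq> G' (r \<alpha>) (\<epsilon> l + s \<alpha>)" if "\<alpha> \<in> A.Q" "l \<in> Zn n" for \<alpha> l
  proof (cases "\<alpha> = 0")
    case False
    show ?thesis
    proof (cases "l \<in> Su \<alpha>")
      case True
      then have "\<alpha> \<in> A.R" using False A.LT1 unfolding Su_def by blast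
      then show ?thesis using root True by blast
    next
      case False then show ?thesis using B.G_zero unfolding Su_def by simp
    qed
  next
    case True
    \<comment> \<open>For opposite roots the contributions of s cancel, so the bracket has second
      degree \<open>\<epsilon> l\<close> whatever \<beta> and \<mu> are.\<close>
    have "br x y \<in> G' 0 (\<epsilon> l)" if R: "\<beta> \<in> A.R" and x: "x \<in> G \<beta> \<mu>" and y: "y \<in> G (- \<beta>) (l - \<mu>)" for \<beta> \<mu> x y
    proof (cases "x = 0 \<or> y = 0")
      case True then show ?thesis using B.G_zero by auto
    next
      case False
      then have Su: "\<mu> \<in> Su \<beta>" "l - \<mu> \<in> Su (- \<beta>)" using x y unfolding Su_def by blast+
      have Q: "\<beta> \<in> A.Q" using R A.D_subset_Q by blast
      have "x \<in> G' (r \<beta>) (\<epsilon> \<mu> + s \<beta>)" "y \<in> G' (r (- \<beta>)) (\<epsilon> (l - \<mu>) + s (- \<beta>))"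
        using root[OF R Su(1)] root[OF A.minus_R[OF R] Su(2)] x y by blast+
      from B.br_G[OF this] have b: "br x y \<in> G' 0 ((\<epsilon> \<mu> + s \<beta>) + (\<epsilon> (l - \<mu>) - s \<beta>))"
        unfolding rminus[OF Q] group_hom_minus[OF sh' Q] add.right_inverse add_uminus_conv_diff .
      have "\<epsilon> (\<mu> + (l - \<mu>)) = \<epsilon> \<mu> + \<epsilon> (l - \<mu>)"
        using \<epsilon>h Su_Zn[OF Su(1)] Su_Zn[OF Su(2)] unfolding is_group_hom_def by blast
      then have "(\<epsilon> \<mu> + s \<beta>) + (\<epsilon> (l - \<mu>) - s \<beta>) = \<epsilon> l" by simp
      with b show ?thesis by (simp only:)
    qed
    then have "{br x y | \<beta> \<mu> x y. \<beta> \<in> A.R \<and> x \<in> G \<beta> \<mu> \<and> y \<in> G (- \<beta>) (l - \<mu>)} \<subseteq> G' 0 (\<epsilon> l)" by blast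
    from A.span_minimal[OF this B.subspace_G] A.zero_space_span[of l] have "G 0 l \<subseteq> G' 0 (\<epsilon> l)" by blast
    then show ?thesis using True r0 group_hom_zero[OF sh' subgroup_gen_zero] by simp
  qed
  have "G' (r \<alpha>) (\<epsilon> l + s \<alpha>) \<subseteq> G \<alpha> l" if \<alpha>: "\<alpha> \<in> A.Q" and l: "l \<in> Zn n" for \<alpha> l
  proof
    fix y assume y: "y \<in> G' (r \<alpha>) (\<epsilon> l + s \<alpha>)"
    \<comment> \<open>An injective relabelling of degrees. By \<open>incl\<close> the first
      decomposition of y is, after relabelling, also its second one; as y is homogeneous of the
      degree \<open>idx (\<alpha>, l)\<close>, only its component at (\<alpha>, l) survives.\<close>
    define idx where "idx p = (r (fst p), \<epsilon> (snd p) + s (fst p))" for p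
    have idx_inj: "inj_on idx (A.Q \<times> Zn n)"
    proof (rule inj_onI)
      fix p q assume pq: "p \<in> A.Q \<times> Zn n" "q \<in> A.Q \<times> Zn n" and e: "idx p = idx q"
      then have f: "fst p = fst q" using inj_onD[OF rinj, of "fst p" "fst q"] by (auto simp: idx_def)
      then have "snd p = snd q" using inj_onD[OF \<epsilon>inj, of "snd p" "snd q"] pq e by (auto simp: idx_def)
      then show "p = q" using f by (simp add: prod_eq_iff)
    qed
    have supp: "p \<in> A.Q \<times> Zn n" if "A.comp y p \<noteq> 0" for p
      using that A.comp_in[of y "fst p" "snd p"] A.G_outside[of "fst p" "snd p"] by (cases p) auto
    have in': "A.comp y p \<in> G' (fst (idx p)) (snd (idx p))" for p
    proof (cases "A.comp y p = 0")
      case False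
      then have "p \<in> A.Q \<times> Zn n" by (rule supp)
      then show ?thesis using incl[of "fst p" "snd p"] A.comp_in[of y "fst p" "snd p"]
        by (auto simp: idx_def)
    qed simp
    have *: "A.comp y p = 0" if p: "p \<noteq> (\<alpha>, l)" for p
    proof (rule ccontr)
      assume nz: "A.comp y p \<noteq> 0"
      have ne: "idx p \<noteq> idx (\<alpha>, l)" using inj_onD[OF idx_inj, of p "(\<alpha>, l)"] supp[OF nz] \<alpha> l p by auto
      have "B.comp (A.comp y q) (idx p) = (if q = p then A.comp y p else 0)" if "A.comp y q \<noteq> 0" for q
        using B.comp_hom[OF in'[of q], of "idx p"] inj_onD[OF idx_inj, of p q] supp[OF nz] supp[OF that] by auto
      then have "B.comp (\<Sum>q | A.comp y q \<noteq> 0. A.comp y q) (idx p) = (\<Sum>q | A.comp y q \<noteq> 0. if q = p then A.comp y p else 0)"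
        unfolding B.comp_sum by (intro sum.cong refl) blast
      also have "\<dots> = A.comp y p" using A.finite_comp nz by (simp add: sum.delta)
      finally have "B.comp y (idx p) = A.comp y p" unfolding A.sum_comp[symmetric] .
      moreover have "B.comp y (idx p) = 0" using B.comp_hom[OF y, of "idx p"] ne
        unfolding idx_def[of "(\<alpha>, l)"] fst_conv snd_conv by (simp only: if_False)
      ultimately show False using nz by simp
    qed
    have "A.comp y p = A.comp (A.comp y (\<alpha>, l)) p" for p
      using *[of p] A.comp_hom[OF A.comp_in[of y \<alpha> l], of p] by simp
    then have "y = A.comp y (\<alpha>, l)" by (rule A.comp_eqI)
    then show "y \<in> G \<alpha> l" using A.comp_in[of y \<alpha> l] by metis
  qed
  with incl have "\<forall>\<alpha>\<in>A.Q. \<forall>l\<in>Zn n. G \<alpha> l = G' (r \<alpha>) (\<epsilon> l + s \<alpha>)" by blast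
  then show ?thesis using r(1) \<epsilon>iso' sh' by blast
qed

end

section \<open>Transport along isomorphisms\<close>

lemma lie_torus_transport:
  fixes sc :: "'k::field_char_0 \<Rightarrow> 'a::ab_group_add \<Rightarrow> 'a" and sc' :: "'k \<Rightarrow> 'b::ab_group_add \<Rightarrow> 'b"
  assumes iso: "lie_iso sc br sc' br' \<phi>" and alg': "lie_algebra sc' br'" and tor: "lie_torus sc br D n G"
  shows "lie_torus sc' br' D n (\<lambda>\<alpha> l. \<phi> ` G \<alpha> l)"
proof -
  interpret A: lie_torus_on sc br D n G by unfold_locales (rule tor)
  have lin: "Vector_Spaces.linear sc sc' \<phi>" and hom: "\<And>x y. \<phi> (br x y) = br' (\<phi> x) (\<phi> y)" and bij: "bij \<phi>"
    using iso by (auto simp: lie_iso_def lie_hom_def)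
  interpret \<phi>: Vector_Spaces.linear sc sc' \<phi> by (rule lin)
  have inj: "\<phi> x = \<phi> y \<longleftrightarrow> x = y" for x y using bij by (auto simp: bij_def inj_def)
  have inj0: "\<phi> x = 0 \<longleftrightarrow> x = 0" for x using inj[of x 0] \<phi>.zero by simp
  obtain \<psi> where \<psi>: "\<And>x. \<psi> (\<phi> x) = x" "\<And>y. \<phi> (\<psi> y) = y"
    using bij by (metis bij_inv_eq_iff)
  have im0: "\<phi> ` S = {0} \<longleftrightarrow> S = {0}" for S
  proof
    assume *: "\<phi> ` S = {0}"
    then obtain x where "x \<in> S" by blast
    moreover have "x = 0" if "x \<in> S" for x using * that inj0 by blast
    ultimately show "S = {0}" by blast
  qed (simp add: \<phi>.zero)
  let ?G = "\<lambda>\<alpha> l. \<phi> ` G \<alpha> l"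
  define P where "P y g \<longleftrightarrow> finite {p. g (fst p) (snd p) \<noteq> 0} \<and> (\<forall>\<alpha> la. g \<alpha> la \<in> \<phi> ` G \<alpha> la) \<and>
              y = (\<Sum>p\<in>{p. g (fst p) (snd p) \<noteq> 0}. g (fst p) (snd p))" for y and g :: "rvec \<Rightarrow> (nat \<Rightarrow> int) \<Rightarrow> 'b"
  \<comment> \<open>Decompositions of the image of x are exactly the images of decompositions of x,
    so existence and uniqueness both pass across the bijection.\<close>
  have P: "P (\<phi> x) (\<lambda>\<alpha> l. \<phi> (f \<alpha> l)) \<longleftrightarrow> A.is_decomp x f" for x f
    unfolding P_def A.is_decomp_def inj0 \<phi>.sum[symmetric] inj inj_image_mem_iff[OF bij_is_inj[OF bij]] ..
  have "\<exists>!g. P y g" for y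
  proof (rule ex_ex1I)
    obtain f where "A.is_decomp (\<psi> y) f" using A.ex1_decomp by blast
    then have "P (\<phi> (\<psi> y)) (\<lambda>\<alpha> l. \<phi> (f \<alpha> l))" using P by blast
    then show "\<exists>g. P y g" unfolding \<psi> by blast
  next
    fix g g' assume *: "P y g" "P y g'"
    have "A.is_decomp (\<psi> y) (\<lambda>\<alpha> l. \<psi> (h \<alpha> l))" if "P y h" for h
      using that unfolding P[symmetric] \<psi> .
    then have e: "(\<lambda>\<alpha> l. \<psi> (g \<alpha> l)) = (\<lambda>\<alpha> l. \<psi> (g' \<alpha> l))" using * A.ex1_decomp by blast
    show "g = g'"
    proof (intro ext)
      fix \<alpha> l
      have "\<psi> (g \<alpha> l) = \<psi> (g' \<alpha> l)" using fun_cong[OF fun_cong[OF e]] .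
      then show "g \<alpha> l = g' \<alpha> l" using \<psi>(2) by metis
    qed
  qed
  then have dec: "\<forall>y. \<exists>!g. finite {p. g (fst p) (snd p) \<noteq> 0} \<and> (\<forall>\<alpha> la. g \<alpha> la \<in> ?G \<alpha> la) \<and>
              y = (\<Sum>p\<in>{p. g (fst p) (snd p) \<noteq> 0}. g (fst p) (snd p))"
    unfolding P_def by (rule allI)
  have grading: "is_grading sc' br' (subgroup_gen D) (Zn n) ?G"
    unfolding is_grading_def im0
  proof (intro conjI)
    show "\<forall>\<alpha> \<beta> la mu. \<forall>x\<in>?G \<alpha> la. \<forall>y\<in>?G \<beta> mu. br' x y \<in> ?G (\<alpha> + \<beta>) (la + mu)"
      using A.br_G unfolding hom[symmetric] ball_simps by blast
  qed (use dec \<phi>.subspace_image[OF A.subspace_G] A.G_outside in blast)+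
  have gcomp: "gcomp_root sc' ?G \<alpha> = \<phi> ` gcomp_root sc G \<alpha>" for \<alpha>
    unfolding gcomp_root_def image_UN[symmetric] \<phi>.span_image ..
  have lt2: "\<forall>\<alpha>\<in>D - {0}. \<forall>la. ?G \<alpha> la \<noteq> {0} \<longrightarrow>
        (\<exists>e f. e \<in> ?G \<alpha> la \<and> f \<in> ?G (- \<alpha>) (- la) \<and>
           ?G \<alpha> la = {sc' c e | c. True} \<and> ?G (- \<alpha>) (- la) = {sc' c f | c. True} \<and>
           (\<forall>\<beta>\<in>subgroup_gen D. \<forall>m::int. real_of_int m = cartan \<beta> \<alpha> \<longrightarrow>
              (\<forall>x\<in>gcomp_root sc' ?G \<beta>. br' (br' e f) x = sc' (of_int m) x)))"
  proof (intro ballI allI impI)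
    fix \<alpha> l assume \<alpha>: "\<alpha> \<in> D - {0}" and nz: "?G \<alpha> l \<noteq> {0}"
    have "\<forall>\<alpha>\<in>D - {0}. \<forall>la. G \<alpha> la \<noteq> {0} \<longrightarrow>
        (\<exists>e f. e \<in> G \<alpha> la \<and> f \<in> G (- \<alpha>) (- la) \<and>
           G \<alpha> la = {sc c e | c. True} \<and> G (- \<alpha>) (- la) = {sc c f | c. True} \<and>
           (\<forall>\<beta>\<in>subgroup_gen D. \<forall>m::int. real_of_int m = cartan \<beta> \<alpha> \<longrightarrow>
              (\<forall>x\<in>gcomp_root sc G \<beta>. br (br e f) x = sc (of_int m) x)))"
      using tor unfolding lie_torus_def by (elim conjE)
    from this[rule_format, OF \<alpha>, of l] nz obtain e f where ef: "e \<in> G \<alpha> l" "f \<in> G (- \<alpha>) (- l)"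
       "G \<alpha> l = {sc c e | c. True}" "G (- \<alpha>) (- l) = {sc c f | c. True}"
      and act: "\<And>\<beta> m x. \<beta> \<in> subgroup_gen D \<Longrightarrow> real_of_int m = cartan \<beta> \<alpha> \<Longrightarrow> x \<in> gcomp_root sc G \<beta> \<Longrightarrow>
         br (br e f) x = sc (of_int m) x"
      unfolding im0 by blast
    have line: "\<phi> ` {sc c x | c. True} = {sc' c (\<phi> x) | c. True}" for x
      by (auto simp: \<phi>.scale[symmetric])
    show "\<exists>e f. e \<in> ?G \<alpha> l \<and> f \<in> ?G (- \<alpha>) (- l) \<and>
           ?G \<alpha> l = {sc' c e | c. True} \<and> ?G (- \<alpha>) (- l) = {sc' c f | c. True} \<and>
           (\<forall>\<beta>\<in>subgroup_gen D. \<forall>m::int. real_of_int m = cartan \<beta> \<alpha> \<longrightarrow>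
              (\<forall>x\<in>gcomp_root sc' ?G \<beta>. br' (br' e f) x = sc' (of_int m) x))"
    proof (intro exI conjI ballI allI impI)
      show "\<phi> e \<in> ?G \<alpha> l" "\<phi> f \<in> ?G (- \<alpha>) (- l)" using ef by auto
      show "?G \<alpha> l = {sc' c (\<phi> e) | c. True}" unfolding ef(3) by (rule line)
      show "?G (- \<alpha>) (- l) = {sc' c (\<phi> f) | c. True}" unfolding ef(4) by (rule line)
      fix \<beta> m y assume "\<beta> \<in> subgroup_gen D" "real_of_int m = cartan \<beta> \<alpha>" "y \<in> gcomp_root sc' ?G \<beta>"
      then show "br' (br' (\<phi> e) (\<phi> f)) y = sc' (of_int m) y"
        unfolding gcomp using act by (auto simp flip: hom \<phi>.scale)
    qed
  qed
  have lt3: "lie_gen sc' br' (\<Union>\<alpha>\<in>D - {0}. gcomp_root sc' ?G \<alpha>) = UNIV"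
  proof -
    have "T = UNIV" if T: "module.subspace sc' T" "\<forall>x\<in>T. \<forall>y\<in>T. br' x y \<in> T"
      "(\<Union>\<alpha>\<in>D - {0}. gcomp_root sc' ?G \<alpha>) \<subseteq> T" for T
    proof -
      have "A.subspace (\<phi> -` T)" by (rule \<phi>.subspace_vimage[OF T(1)])
      moreover have "\<forall>x\<in>\<phi> -` T. \<forall>y\<in>\<phi> -` T. br x y \<in> \<phi> -` T" using T(2) hom by simp
      moreover have "(\<Union>\<alpha>\<in>D - {0}. gcomp_root sc G \<alpha>) \<subseteq> \<phi> -` T" using T(3) unfolding gcomp by blast
      ultimately have "\<phi> -` T = UNIV" using A.LT3 unfolding lie_gen_def by blast
      then have "y \<in> T" for y using \<psi>(2)[of y] by (metis UNIV_I vimage_eq)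
      then show ?thesis by blast
    qed
    then show ?thesis unfolding lie_gen_def by blast
  qed
  have "{\<alpha>. \<exists>la. G \<alpha> la \<noteq> {0}} = D" "\<forall>\<alpha>\<in>indivisible_roots D. G \<alpha> 0 \<noteq> {0}"
    using A.LT1 A.LT2i by blast+
  then show ?thesis
    unfolding lie_torus_def using alg' A.irr grading lt2 lt3 A.LT4 unfolding im0 by (intro conjI) assumption+
qed

lemma lie_iso_comp:
  assumes "lie_iso sc br sc' br' \<phi>" "lie_iso sc' br' sc'' br'' \<psi>" shows "lie_iso sc br sc'' br'' (\<psi> \<circ> \<phi>)"
  using assms unfolding lie_iso_def lie_hom_def by (auto intro: Vector_Spaces.linear_compose bij_comp)

theorem theorem11p2:
  fixes sc :: "'k::field_char_0 \<Rightarrow> 'a::ab_group_add \<Rightarrow> 'a" and br :: "'a \<Rightarrow> 'a \<Rightarrow> 'a"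
    and sc' :: "'k \<Rightarrow> 'b::ab_group_add \<Rightarrow> 'b" and br' :: "'b \<Rightarrow> 'b \<Rightarrow> 'b"
    and D D' :: "rvec set" and n n' :: nat
    and G :: "rvec \<Rightarrow> (nat \<Rightarrow> int) \<Rightarrow> 'a set" and G' :: "rvec \<Rightarrow> (nat \<Rightarrow> int) \<Rightarrow> 'b set"
  assumes "alg_closed TYPE('k)"
    and "lie_torus sc br D n G" and "fgc sc br" and "centreless br" and "assumption_C sc br"
    and "lie_torus sc' br' D' n' G'" and "fgc sc' br'" and "centreless br'" and "assumption_C sc' br'"
  shows "lie_isomorphic sc br sc' br' \<longleftrightarrow> isotopic sc br D n G sc' br' D' n' G'"
proof
  assume "isotopic sc br D n G sc' br' D' n' G'"
  then show "lie_isomorphic sc br sc' br'"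
    unfolding isotopic_def isotopy_def lie_isomorphic_def by blast
next
  assume "lie_isomorphic sc br sc' br'"
  then obtain \<phi> where \<phi>: "lie_iso sc br sc' br' \<phi>" unfolding lie_isomorphic_def by blast
  have alg': "lie_algebra sc' br'" using assms(6) by (simp add: lie_torus_def)
  obtain \<psi> where \<psi>: "lie_iso sc' br' sc' br' \<psi>" "\<psi> ` \<phi> ` G 0 0 = G' 0 0"
    using assms(6,9) lie_torus_transport[OF \<phi> alg' assms(2)] unfolding assumption_C_def by blast
  let ?\<chi> = "\<psi> \<circ> \<phi>"
  have \<chi>: "lie_iso sc br sc' br' ?\<chi>" by (rule lie_iso_comp[OF \<phi> \<psi>(1)])
  \<comment> \<open>The first grading is carried over along the composite map, so that equality of
    components in the target algebra is precisely the isotopy condition for that map.\<close>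
  interpret two_tori sc' br' D n "\<lambda>\<alpha> l. ?\<chi> ` G \<alpha> l" D' n' G'
    by unfold_locales (use lie_torus_transport[OF \<chi> alg' assms(2)] assms(6) \<psi>(2) in \<open>auto simp: image_comp\<close>)
  have "isotopy sc br D n G sc' br' D' n' G' ?\<chi>"
    unfolding isotopy_def using \<chi> ex_isotopy by blast
  then show "isotopic sc br D n G sc' br' D' n' G'" unfolding isotopic_def by blast
qed

end
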